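(* Let $\mathcal{A}$ be a $C^*$-algebra with unit $e$, let $\Phi\colon\mathcal{A}\to\mathcal{A}$ be a linear map which is positive and unital, and let $a\in\mathcal{A}$ be a normal element. The following assertions are equivalent: (i) $\Phi(a)=a$ and $\Phi(a^*a)=a^*a$. (ii) $\Phi(b)=b$ for all $b\in C^*(e,a)$.
   Context: $C^*(e,a)$ denotes the $C^*$-subalgebra of $\mathcal{A}$ generated by $e$ and $a$. A linear map $\Phi$ is positive if it maps positive elements to positive elements, and unital if $\Phi(e)=e$. An element $a$ is normal if $a^*a=aa^*$. *)

theory Defs
  imports "HOL-Complex_Analysis.Complex_Analysis"
begin

text \<open>
  The real scalar multiplication is inherited from \<^class>\<open>real_normed_algebra\<close>, so it has to be tied
  to the complex one; \<open>scaleC 1 x = x\<close> follows from this.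
\<close>

class cstar_algebra = real_normed_algebra + banach +
  fixes scaleC :: "complex \<Rightarrow> 'a \<Rightarrow> 'a"  (infixr "*\<^sub>C" 75)
    and star :: "'a \<Rightarrow> 'a"
  assumes scaleR_scaleC: "r *\<^sub>R x = complex_of_real r *\<^sub>C x"
    and scaleC_add_right: "c *\<^sub>C (x + y) = c *\<^sub>C x + c *\<^sub>C y"
    and scaleC_add_left: "(c + d) *\<^sub>C x = c *\<^sub>C x + d *\<^sub>C x"
    and scaleC_scaleC: "c *\<^sub>C (d *\<^sub>C x) = (c * d) *\<^sub>C x"
    and norm_scaleC: "norm (c *\<^sub>C x) = cmod c * norm x"
    and mult_scaleC_left: "(c *\<^sub>C x) * y = c *\<^sub>C (x * y)"
    and mult_scaleC_right: "x * (c *\<^sub>C y) = c *\<^sub>C (x * y)"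
    and star_star: "star (star x) = x"
    and star_add: "star (x + y) = star x + star y"
    and star_scaleC: "star (c *\<^sub>C x) = cnj c *\<^sub>C star x"
    and star_mult: "star (x * y) = star y * star x"
    and cstar_identity: "norm (star x * x) = (norm x)\<^sup>2"

text \<open>
  Based on \<^class>\<open>monoid_mult\<close> rather than \<^class>\<open>ring_1\<close>, since the latter demands \<open>0 \<noteq> 1\<close> and would
  exclude the zero algebra.
\<close>

class unital_cstar_algebra = cstar_algebra + monoid_mult

instantiation complex :: unital_cstar_algebra
begin

definition scaleC_complex :: "complex \<Rightarrow> complex \<Rightarrow> complex" where
  "scaleC_complex c x = c * x"

definition star_complex :: "complex \<Rightarrow> complex" where
  "star_complex = cnj"

instance
  by standard
    (simp_all add: scaleC_complex_def star_complex_def algebra_simps scaleR_conv_of_real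
      norm_mult power2_eq_square)

end

lemma vector_space_scaleC: "vector_space (scaleC :: complex \<Rightarrow> 'a::cstar_algebra \<Rightarrow> 'a)"
proof
  show "1 *\<^sub>C x = x" for x :: 'a
    using scaleR_scaleC[of 1 x] by simp
qed (simp_all add: scaleC_add_right scaleC_add_left scaleC_scaleC)

definition normal_element :: "'a::cstar_algebra \<Rightarrow> bool" where
  "normal_element x \<longleftrightarrow> star x * x = x * star x"

definition invertible_element :: "'a::unital_cstar_algebra \<Rightarrow> bool" where
  "invertible_element x \<longleftrightarrow> (\<exists>y. x * y = 1 \<and> y * x = 1)"

definition spectrum :: "'a::unital_cstar_algebra \<Rightarrow> complex set" where
  "spectrum x = {c. \<not> invertible_element (x - c *\<^sub>C 1)}"

definition positive_element :: "'a::unital_cstar_algebra \<Rightarrow> bool" where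
  "positive_element x \<longleftrightarrow> star x = x \<and> spectrum x \<subseteq> complex_of_real ` {0..}"

definition positive_map :: "('a::unital_cstar_algebra \<Rightarrow> 'b::unital_cstar_algebra) \<Rightarrow> bool" where
  "positive_map \<Phi> \<longleftrightarrow> (\<forall>x. positive_element x \<longrightarrow> positive_element (\<Phi> x))"

definition unital_map :: "('a::unital_cstar_algebra \<Rightarrow> 'b::unital_cstar_algebra) \<Rightarrow> bool" where
  "unital_map \<Phi> \<longleftrightarrow> \<Phi> 1 = 1"

definition cstar_subalgebra :: "'a::cstar_algebra set \<Rightarrow> bool" where
  "cstar_subalgebra B \<longleftrightarrow>
     module.subspace scaleC B \<and> closed B \<and>
     (\<forall>x\<in>B. \<forall>y\<in>B. x * y \<in> B) \<and> (\<forall>x\<in>B. star x \<in> B)"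

definition cstar_generated :: "'a::cstar_algebra set \<Rightarrow> 'a set" where
  "cstar_generated S = \<Inter> {B. cstar_subalgebra B \<and> S \<subseteq> B}"

end

theory Submission
  imports Defs
begin

text \<open>
  Write \<open>a = h + \<i> k\<close> with \<open>h\<close> and \<open>k\<close> self-adjoint. They commute because \<open>a\<close> is normal, so
  \<open>a\<^sup>* a = h\<^sup>2 + k\<^sup>2\<close>. A positive map preserves the star, so (i) says that \<open>\<Phi>\<close> fixes \<open>h\<close>, \<open>k\<close> and \<open>h\<^sup>2 + k\<^sup>2\<close>.
  Kadison's inequality \<open>\<Phi> (x\<^sup>2) \<ge> (\<Phi> x)\<^sup>2\<close> for self-adjoint \<open>x\<close> (\<open>kadison_inequality\<close>) gives
  \<open>\<Phi> (h\<^sup>2) \<ge> h\<^sup>2\<close> and \<open>\<Phi> (k\<^sup>2) \<ge> k\<^sup>2\<close>. Equality holds for the sum, hence for both summands.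

  Equality in Kadison's inequality at \<open>h\<close> makes \<open>\<Phi>\<close> multiplicative for Jordan products with \<open>h\<close>:
  \<open>\<Phi> (h x + x h) = \<Phi> h \<Phi> x + \<Phi> x \<Phi> h\<close> for all \<open>x\<close> (\<open>jordan_multiplicative\<close>). So if \<open>x\<close> is a fixed point that
  commutes with \<open>a\<close> and \<open>a\<^sup>*\<close>, then \<open>h x\<close> and \<open>k x\<close>, and therefore \<open>a x\<close> and \<open>a\<^sup>* x\<close>, are again such fixed points.
  Starting from \<open>1\<close>, one reaches all polynomials in \<open>a\<close> and \<open>a\<^sup>*\<close>, and the rest of \<open>C\<^sup>*(e, a)\<close> by continuity; the
  formal argument shows that the multipliers of this space of fixed points form a \<open>C\<^sup>*\<close>-subalgebra
  that contains \<open>1\<close> and \<open>a\<close> (\<open>cstar_subalgebra_multipliers\<close>).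

  Kadison's inequality is proved with polynomials in place of the continuous functional calculus: the
  Bernstein polynomials at \<open>x\<close> serve as a positive partition of unity that almost diagonalises \<open>x\<close>. This
  needs the order structure of a \<open>C\<^sup>*\<close>-algebra with positivity defined by the spectrum: the positive elements form
  a closed convex cone (\<open>positive_iff_norm\<close>), which contains all \<open>c\<^sup>* c\<close> (\<open>positive_star_mult\<close>) and is
  stable under \<open>q \<mapsto> w\<^sup>* q w\<close> (\<open>positive_sandwich\<close>). All of these rest on the fact that a
  self-adjoint element has a spectral value of modulus at least its norm
  (\<open>spectral_value_of_large_modulus\<close>).
\<close>


section \<open>Scalars, star and invertibility\<close>

interpretation scaleC: vector_space "scaleC :: complex \<Rightarrow> 'a::cstar_algebra \<Rightarrow> 'a"
  by (rule vector_space_scaleC)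

lemma scaleC_of_real: "complex_of_real r *\<^sub>C x = r *\<^sub>R x"
  by (simp add: scaleR_scaleC)

lemma scaleC_scaleR_commute: "c *\<^sub>C (r *\<^sub>R x) = r *\<^sub>R (c *\<^sub>C x)"
  by (simp add: scaleR_scaleC mult.commute)

lemma star_zero [simp]: "star (0::'a::cstar_algebra) = 0"
  using star_add[of 0 "0::'a"] by simp

lemma star_scaleR: "star (r *\<^sub>R x) = r *\<^sub>R star x"
  by (simp add: scaleR_scaleC star_scaleC)

lemma star_minus: "star (- x) = - star x"
  using star_scaleR[of "-1" x] by simp

lemma star_diff: "star (x - y) = star x - star y"
  using star_add[of x "- y"] by (simp add: star_minus)

lemma star_one [simp]: "star (1::'a::unital_cstar_algebra) = 1"
  by (metis star_mult star_star mult_1_left mult_1_right)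

lemma norm_star: "norm (star x) = norm (x::'a::cstar_algebra)"
proof -
  have le: "norm y \<le> norm (star y)" for y :: 'a
  proof (cases "norm y = 0")
    case False
    have "norm y * norm y \<le> norm (star y) * norm y"
      using norm_mult_ineq[of "star y" y] by (simp add: cstar_identity power2_eq_square)
    with False show ?thesis by simp
  qed auto
  show ?thesis
    using le[of x] le[of "star x"] by (simp add: star_star)
qed

lemma bounded_linear_star: "bounded_linear (star :: 'a::cstar_algebra \<Rightarrow> 'a)"
  by (rule bounded_linear_intro[where K = 1]) (simp_all add: star_add star_scaleR norm_star)

lemma norm_one_le: "norm (1::'a::unital_cstar_algebra) \<le> 1"
proof -
  have "norm (1::'a) = (norm (1::'a))\<^sup>2"
    using cstar_identity[of "1::'a"] by simp
  then have "norm (1::'a) = 0 \<or> norm (1::'a) = 1"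
    by (simp add: power2_eq_square)
  then show ?thesis by auto
qed

lemma norm_power_le: "norm ((x::'a::unital_cstar_algebra) ^ n) \<le> norm x ^ n"
proof (induction n)
  case (Suc n)
  have "norm (x ^ Suc n) \<le> norm x * norm (x ^ n)"
    by (simp add: norm_mult_ineq)
  also have "\<dots> \<le> norm x * norm x ^ n"
    using Suc.IH by (simp add: mult_left_mono)
  finally show ?case by simp
qed (simp add: norm_one_le)

lemma norm_mult3_le: "norm (x * y * z) \<le> norm x * norm y * norm (z::'a::real_normed_algebra)"
  by (rule order_trans[OF norm_mult_ineq mult_right_mono[OF norm_mult_ineq norm_ge_zero]])

lemma invertible_mult:
  assumes "invertible_element x" "invertible_element y"
  shows "invertible_element (x * y)"
proof -
  obtain x' y' where "x * x' = 1" "x' * x = 1" "y * y' = 1" "y' * y = 1"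
    using assms by (auto simp: invertible_element_def)
  then have "x * y * (y' * x') = 1" "y' * x' * (x * y) = 1"
    by (metis mult.assoc mult_1_right)+
  then show ?thesis
    by (auto simp: invertible_element_def)
qed

lemma invertible_commuting_factor:
  assumes "invertible_element (x * y)" "x * y = y * x"
  shows "invertible_element x"
proof -
  obtain z where z: "x * y * z = 1" "z * (x * y) = 1"
    using assms by (auto simp: invertible_element_def)
  have r: "x * (y * z) = 1" and l: "z * y * x = 1"
    using z by (metis assms(2) mult.assoc)+
  have "z * y = y * z"
    by (metis r l mult.assoc mult_1_left mult_1_right)
  then show ?thesis
    using r l by (auto simp: invertible_element_def)
qed

lemma invertible_scaleC:
  assumes "c \<noteq> 0" "invertible_element x"
  shows "invertible_element (c *\<^sub>C x)"
proof -
  obtain y where "x * y = 1" "y * x = 1"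
    using assms by (auto simp: invertible_element_def)
  then have "c *\<^sub>C x * (inverse c *\<^sub>C y) = 1" "inverse c *\<^sub>C y * (c *\<^sub>C x) = 1"
    using assms(1) by (simp_all add: mult_scaleC_left mult_scaleC_right)
  then show ?thesis
    by (auto simp: invertible_element_def)
qed

lemma invertible_scaleC_iff:
  assumes "c \<noteq> 0"
  shows "invertible_element (c *\<^sub>C x) \<longleftrightarrow> invertible_element x"
  using invertible_scaleC[OF assms, of x] invertible_scaleC[of "inverse c" "c *\<^sub>C x"] assms
  by auto

lemma invertible_one: "invertible_element 1"
  by (auto simp: invertible_element_def intro!: exI[of _ 1])

text \<open>
  The inverse is the Neumann series \<open>\<Sum>x\<^sup>n\<close>.
\<close>
lemma invertible_one_minus:
  fixes x :: "'a::unital_cstar_algebra"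
  assumes "norm x < 1"
  shows "invertible_element (1 - x)"
proof -
  have sm: "summable (\<lambda>n. x ^ n)"
  proof (rule summable_comparison_test)
    show "\<exists>N. \<forall>n\<ge>N. norm (x ^ n) \<le> norm x ^ n"
      by (simp add: norm_power_le)
    show "summable (\<lambda>n. norm x ^ n)"
      using assms by (simp add: summable_geometric)
  qed
  define s where "s = (\<Sum>n. x ^ n)"
  have shift: "(\<Sum>n. x ^ Suc n) = s - 1"
    using suminf_split_head[OF sm] by (simp add: s_def)
  have "x * s = s - 1"
    using suminf_mult[OF sm, of x] shift by (simp add: s_def)
  moreover have "s * x = s - 1"
    using suminf_mult2[OF sm, of x] shift by (simp add: s_def power_commutes)
  ultimately have "(1 - x) * s = 1" "s * (1 - x) = 1"
    by (simp_all add: algebra_simps)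
  then show ?thesis
    by (auto simp: invertible_element_def)
qed

lemma spectrum_norm_le:
  assumes "l \<in> spectrum x"
  shows "cmod l \<le> norm x"
proof (rule ccontr)
  assume "\<not> cmod l \<le> norm x"
  then have lt: "norm x < cmod l" and l0: "l \<noteq> 0"
    by (auto simp: not_le)
  have "norm (inverse l *\<^sub>C x) < 1"
    using lt l0 by (simp add: norm_scaleC norm_inverse divide_inverse[symmetric] mult.commute)
  then have "invertible_element ((- l) *\<^sub>C (1 - inverse l *\<^sub>C x))"
    using l0 by (intro invertible_scaleC invertible_one_minus) auto
  moreover have "(- l) *\<^sub>C (1 - inverse l *\<^sub>C x) = x - l *\<^sub>C 1"
    using l0 by (simp add: scaleC.scale_right_diff_distrib)
  ultimately show False
    using assms by (simp add: spectrum_def)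
qed

lemma spectrum_shift:
  "l \<in> spectrum (x + c *\<^sub>C 1) \<longleftrightarrow> l - c \<in> spectrum x"
  by (simp add: spectrum_def scaleC.scale_left_diff_distrib algebra_simps)

lemma spectrum_scale:
  assumes "c \<noteq> 0"
  shows "l \<in> spectrum (c *\<^sub>C x) \<longleftrightarrow> l / c \<in> spectrum x"
proof -
  have "c *\<^sub>C x - l *\<^sub>C 1 = c *\<^sub>C (x - (l / c) *\<^sub>C 1)"
    using assms by (simp add: scaleC.scale_right_diff_distrib)
  then show ?thesis
    using invertible_scaleC_iff[OF assms] by (simp add: spectrum_def)
qed

text \<open>
  Adding \<open>\<i> t\<close> to a self-adjoint element increases its squared norm by at most \<open>t\<^sup>2\<close>,
  while a non-real spectral value moved by \<open>\<i> t\<close> has its squared modulus increased by an additional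
  term that is linear in \<open>t\<close>.
\<close>
lemma spectrum_selfadjoint_real:
  assumes x: "star x = x" and l: "l \<in> spectrum x"
  shows "Im l = 0"
proof -
  have bound: "2 * t * Im l \<le> (norm x)\<^sup>2" for t :: real
  proof -
    let ?c = "\<i> * complex_of_real t"
    let ?y = "x + ?c *\<^sub>C 1"
    have cc: "(?c * ?c) *\<^sub>C (1::'a) = - ((complex_of_real t * complex_of_real t) *\<^sub>C 1)"
      by (metis mult.assoc mult.left_commute i_squared mult_minus1 scaleC.scale_minus_left)
    have "l + ?c \<in> spectrum ?y"
      using l by (simp add: spectrum_shift)
    then have "(cmod (l + ?c))\<^sup>2 \<le> (norm ?y)\<^sup>2"
      by (intro power_mono spectrum_norm_le) auto
    also have "\<dots> = norm (star ?y * ?y)"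
      by (simp add: cstar_identity)
    also have "star ?y * ?y = x * x + t\<^sup>2 *\<^sub>R 1"
      using cc by (simp add: star_add star_scaleC x distrib_left distrib_right mult_scaleC_left
          mult_scaleC_right scaleR_scaleC power2_eq_square scaleC.scale_right_diff_distrib left_diff_distrib)
    also have "norm \<dots> \<le> (norm x)\<^sup>2 + t\<^sup>2"
    proof -
      have "norm (x * x) \<le> (norm x)\<^sup>2"
        using norm_mult_ineq[of x x] by (simp add: power2_eq_square)
      moreover have "norm (t\<^sup>2 *\<^sub>R (1::'a)) \<le> t\<^sup>2"
        using norm_one_le[where 'a='a] by (simp add: mult_left_le)
      ultimately show ?thesis
        by (intro norm_triangle_le) auto
    qed
    finally have "(Re l)\<^sup>2 + (Im l + t)\<^sup>2 \<le> (norm x)\<^sup>2 + t\<^sup>2"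
      by (simp add: cmod_power2)
    moreover have "0 \<le> (Re l)\<^sup>2" "0 \<le> (Im l)\<^sup>2"
      by auto
    moreover have "2 * t * Im l = 2 * Im l * t"
      by simp
    ultimately show ?thesis
      unfolding power2_sum by linarith
  qed
  show ?thesis
  proof (rule ccontr)
    assume "Im l \<noteq> 0"
    then show False
      using bound[of "((norm x)\<^sup>2 + 1) / (2 * Im l)"] by simp
  qed
qed


section \<open>Evaluating polynomials at an element\<close>

text \<open>
  Horner's scheme, with complex coefficients and an argument from the algebra.
\<close>
definition poly_at :: "complex poly \<Rightarrow> 'a::unital_cstar_algebra \<Rightarrow> 'a" where
  "poly_at p x = fold_coeffs (\<lambda>c y. c *\<^sub>C 1 + x * y) p 0"

lemma poly_at_0 [simp]: "poly_at 0 x = 0"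
  by (simp add: poly_at_def)

lemma poly_at_pCons [simp]: "poly_at (pCons c p) x = c *\<^sub>C 1 + x * poly_at p x"
  by (cases "p = 0 \<and> c = 0") (auto simp: poly_at_def)

lemma poly_at_1 [simp]: "poly_at 1 x = 1"
  by (simp add: one_pCons)

lemma poly_at_add: "poly_at (p + q) x = poly_at p x + poly_at q x"
  by (induction p q rule: poly_induct2) (simp_all add: scaleC_add_left algebra_simps)

lemma poly_at_smult: "poly_at (smult c p) x = c *\<^sub>C poly_at p x"
  by (induction p) (simp_all add: scaleC_add_right mult_scaleC_right)

lemma poly_at_minus: "poly_at (- p) x = - poly_at p x"
  using poly_at_smult[of "-1" p x] by simp

lemma poly_at_diff: "poly_at (p - q) x = poly_at p x - poly_at q x"
  using poly_at_add[of p "- q" x] by (simp add: poly_at_minus)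

lemma poly_at_mult: "poly_at (p * q) x = poly_at p x * poly_at q x"
proof (induction p)
  case (pCons c p)
  then show ?case
    by (simp add: mult_pCons_left poly_at_add poly_at_smult distrib_right mult_scaleC_left mult.assoc)
qed simp

lemma poly_at_sum: "poly_at (\<Sum>i\<in>A. p i) x = (\<Sum>i\<in>A. poly_at (p i) x)"
  by (induction A rule: infinite_finite_induct) (simp_all add: poly_at_add)

lemma poly_at_commute: "poly_at p x * poly_at q x = poly_at q x * poly_at p x"
  by (metis poly_at_mult mult.commute)

lemma poly_at_linear: "poly_at [:- z, 1:] x = x - z *\<^sub>C 1"
  by simp

text \<open>
  This transfers identities between real functions, such as those for the Bernstein polynomials, to
  identities between algebra elements.
\<close>
lemma poly_eq_if_eq_on_reals:
  assumes "\<And>t. poly p (complex_of_real t) = poly q (complex_of_real t)"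
  shows "p = q"
proof (rule ccontr)
  assume "p \<noteq> q"
  then have "finite {z. poly (p - q) z = 0}"
    by (intro poly_roots_finite) auto
  moreover have "range complex_of_real \<subseteq> {z. poly (p - q) z = 0}"
    using assms by auto
  ultimately have "finite (range complex_of_real)"
    by (rule rev_finite_subset)
  then show False
    by (simp add: finite_image_iff inj_on_def infinite_UNIV_char_0)
qed

lemma star_poly_at:
  assumes x: "star x = x" and p: "\<And>t. poly p (complex_of_real t) = complex_of_real (f t)"
  shows "star (poly_at p x) = poly_at p x"
proof -
  have *: "star (poly_at q x) = poly_at (map_poly cnj q) x" for q
  proof (induction q)
    case (pCons c q)
    have "x * poly_at (map_poly cnj q) x = poly_at (map_poly cnj q) x * x"
      using poly_at_commute[of "[:0, 1:]" x] by simp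
    with pCons show ?case
      by (simp add: map_poly_pCons star_add star_scaleC star_mult x)
  qed simp
  have "map_poly cnj p = p"
    by (rule poly_eq_if_eq_on_reals) (simp add: p)
  with * show ?thesis by simp
qed

text \<open>
  The fundamental theorem of algebra splits the value of \<open>p\<close> at \<open>x\<close> into factors
  \<open>x - z\<close> for the roots \<open>z\<close> of \<open>p\<close>.
\<close>
lemma invertible_poly_at:
  assumes "p \<noteq> 0" "\<And>z. z \<in> spectrum x \<Longrightarrow> poly p z \<noteq> 0"
  shows "invertible_element (poly_at p x)"
  using assms
proof (induction "degree p" arbitrary: p)
  case 0
  then obtain c where "p = [:c:]" "c \<noteq> 0"
    by (metis degree_eq_zeroE pCons_0_0)
  then show ?case
    by (simp add: invertible_scaleC invertible_one)
next
  case (Suc n)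
  then have "degree p \<in> {1..degree p}" "coeff p (degree p) \<noteq> 0"
    by auto
  then obtain z where "(\<Sum>i\<le>degree p. coeff p i * z ^ i) = 0"
    using fundamental_theorem_of_algebra[of "coeff p" "degree p"] by blast
  then have z: "poly p z = 0"
    by (simp add: poly_altdef)
  then obtain q where q: "p = [:- z, 1:] * q"
    by (auto simp: poly_eq_0_iff_dvd)
  then have "q \<noteq> 0"
    using Suc.prems by auto
  moreover from this have "degree p = Suc (degree q)"
    unfolding q by (subst degree_mult_eq) auto
  ultimately have "invertible_element (poly_at q x)"
    using Suc.hyps Suc.prems(2) by (intro Suc.hyps(1)) (auto simp: q)
  moreover have "invertible_element (x - z *\<^sub>C 1)"
    using z Suc.prems(2) by (auto simp: spectrum_def)
  ultimately show ?case
    unfolding q poly_at_mult poly_at_linear by (intro invertible_mult)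
qed

lemma spectrum_poly_at_subset:
  assumes "spectrum x \<subseteq> S" "S \<noteq> {}"
  shows "spectrum (poly_at p x) \<subseteq> poly p ` S"
proof
  fix m assume m: "m \<in> spectrum (poly_at p x)"
  show "m \<in> poly p ` S"
  proof (rule ccontr)
    assume "m \<notin> poly p ` S"
    then have ne: "poly (p - [:m:]) z \<noteq> 0" if "z \<in> S" for z
      using that by auto
    with assms(2) have "p - [:m:] \<noteq> 0"
      by (metis equals0I poly_0)
    then have "invertible_element (poly_at (p - [:m:]) x)"
      using ne assms(1) by (intro invertible_poly_at) blast+
    with m show False
      by (simp add: spectrum_def poly_at_diff)
  qed
qed

lemma poly_in_spectrum_poly_at:
  assumes "z \<in> spectrum x"
  shows "poly p z \<in> spectrum (poly_at p x)"
proof (rule ccontr)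
  assume "poly p z \<notin> spectrum (poly_at p x)"
  then have inv: "invertible_element (poly_at (p - [:poly p z:]) x)"
    by (simp add: spectrum_def poly_at_diff)
  have "poly (p - [:poly p z:]) z = 0"
    by simp
  then obtain q where q: "p - [:poly p z:] = [:- z, 1:] * q"
    unfolding poly_eq_0_iff_dvd by (elim dvdE)
  have "invertible_element (poly_at [:- z, 1:] x * poly_at q x)"
    using inv unfolding q poly_at_mult .
  then have "invertible_element (poly_at [:- z, 1:] x)"
    using poly_at_commute invertible_commuting_factor by blast
  with assms show False
    unfolding poly_at_linear by (simp add: spectrum_def)
qed


section \<open>Norm and spectrum of self-adjoint elements\<close>

definition inverse_pair :: "'a::monoid_mult \<Rightarrow> 'a \<Rightarrow> bool" where
  "inverse_pair x y \<longleftrightarrow> x * y = 1 \<and> y * x = 1"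

lemma invertible_iff_inverse_pair: "invertible_element x \<longleftrightarrow> (\<exists>y. inverse_pair x y)"
  by (simp add: invertible_element_def inverse_pair_def)

text \<open>
  The resolvent identity.
\<close>
lemma inverse_pair_diff:
  fixes x y :: "'a::unital_cstar_algebra"
  assumes "inverse_pair x u" "inverse_pair y v"
  shows "u - v = u * (y - x) * v"
proof -
  have "u * (y - x) * v = u * (y * v) - (u * x) * v"
    by (simp add: algebra_simps)
  then show ?thesis
    using assms by (simp add: inverse_pair_def)
qed

text \<open>
  The partial fraction decomposition \<open>1 / (1 - g\<^sup>2) = (1 / (1 - g) + 1 / (1 + g)) / 2\<close>.
\<close>
lemma inverse_pair_average:
  fixes g :: "'a::unital_cstar_algebra"
  assumes u: "inverse_pair (1 - g) u" and v: "inverse_pair (1 + g) v"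
  shows "inverse_pair (1 - g * g) ((1/2) *\<^sub>R (u + v))"
proof -
  have f: "1 - g * g = (1 + g) * (1 - g)" "1 - g * g = (1 - g) * (1 + g)"
    by (simp_all add: algebra_simps)
  have "(1 + g) * (1 - g) * u = 1 + g" "(1 - g) * (1 + g) * v = 1 - g"
    using u v by (simp_all add: inverse_pair_def mult.assoc)
  moreover have "u * ((1 - g) * (1 + g)) = 1 + g" "v * ((1 + g) * (1 - g)) = 1 - g"
    using u v by (simp_all add: inverse_pair_def flip: mult.assoc)
  ultimately have "(1 - g * g) * u = 1 + g" "(1 - g * g) * v = 1 - g"
      "u * (1 - g * g) = 1 + g" "v * (1 - g * g) = 1 - g"
    by (simp_all only: f[symmetric])
  then show ?thesis
    by (simp add: inverse_pair_def distrib_left distrib_right flip: scaleR_2)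
qed

text \<open>
  By the resolvent identity the inverse at \<open>z\<close> is at most twice as long as the inverse at \<open>w\<close>
  when \<open>z\<close> is close to \<open>w\<close>; compactness of the disc turns these local bounds into a global one.
\<close>
lemma inverses_bounded_on_disc:
  fixes x :: "'a::unital_cstar_algebra"
  assumes inv: "\<And>z. cmod z \<le> 1 \<Longrightarrow> invertible_element (1 - z *\<^sub>C x)"
  obtains M where "\<And>z u. cmod z \<le> 1 \<Longrightarrow> inverse_pair (1 - z *\<^sub>C x) u \<Longrightarrow> norm u \<le> M"
proof -
  have "\<exists>d K. 0 < d \<and> 0 \<le> K \<and>
      (\<forall>z\<in>ball w d. \<forall>u. inverse_pair (1 - z *\<^sub>C x) u \<longrightarrow> norm u \<le> K)"
    if w: "w \<in> cball 0 1" for w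
  proof -
    obtain v where v: "inverse_pair (1 - w *\<^sub>C x) v"
      using inv[of w] w by (auto simp: invertible_iff_inverse_pair)
    define d where "d = 1 / (2 * (norm x * norm v + 1))"
    have pos: "0 < norm x * norm v + 1"
      by (smt (verit) mult_nonneg_nonneg norm_ge_zero)
    have "norm u \<le> 2 * norm v" if z: "z \<in> ball w d" and u: "inverse_pair (1 - z *\<^sub>C x) u" for z u
    proof -
      have "u - v = (z - w) *\<^sub>C (u * x * v)"
        using inverse_pair_diff[OF u v]
        by (simp add: mult_scaleC_left mult_scaleC_right scaleC.scale_left_diff_distrib[symmetric])
      then have "norm (u - v) \<le> cmod (z - w) * (norm u * norm x * norm v)"
        by (simp add: norm_scaleC mult_left_mono norm_mult3_le)
      also have "\<dots> = cmod (z - w) * (norm x * norm v) * norm u"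
        by simp
      also have "\<dots> \<le> 1 / 2 * norm u"
      proof (rule mult_right_mono)
        have "cmod (z - w) * (norm x * norm v) \<le> d * (norm x * norm v + 1)"
          using z pos by (intro mult_mono) (auto simp: dist_norm norm_minus_commute d_def)
        also have "\<dots> = 1 / 2"
          using pos by (simp add: d_def)
        finally show "cmod (z - w) * (norm x * norm v) \<le> 1 / 2" .
      qed simp
      finally show ?thesis
        using norm_triangle_ineq[of "u - v" v] by simp
    qed
    moreover have "0 < d"
      using pos by (simp add: d_def)
    ultimately show ?thesis
      by (intro exI[of _ d] exI[of _ "2 * norm v"]) auto
  qed
  then have "\<forall>w\<in>cball 0 1. \<exists>dK. 0 < fst dK \<and> 0 \<le> snd dK \<and>
      (\<forall>z\<in>ball w (fst dK). \<forall>u. inverse_pair (1 - z *\<^sub>C x) u \<longrightarrow> norm u \<le> snd dK)"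
    by simp
  then obtain dK where "\<forall>w\<in>cball 0 1. 0 < fst (dK w) \<and> 0 \<le> snd (dK w) \<and>
      (\<forall>z\<in>ball w (fst (dK w)). \<forall>u. inverse_pair (1 - z *\<^sub>C x) u \<longrightarrow> norm u \<le> snd (dK w))"
    by (rule bchoice[THEN exE])
  then obtain d K where dK: "\<And>w. w \<in> cball 0 1 \<Longrightarrow> 0 < d w \<and> 0 \<le> K w \<and>
      (\<forall>z\<in>ball w (d w). \<forall>u. inverse_pair (1 - z *\<^sub>C x) u \<longrightarrow> norm u \<le> K w)"
    using that[of "fst \<circ> dK" "snd \<circ> dK"] by simp
  obtain C where C: "C \<subseteq> cball 0 1" "finite C" "cball 0 1 \<subseteq> (\<Union>w\<in>C. ball w (d w))"
  proof (rule compactE_image[of "cball (0::complex) 1" "cball 0 1" "\<lambda>w. ball w (d w)"])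
    show "cball 0 1 \<subseteq> (\<Union>w\<in>cball 0 1. ball w (d w))"
      using dK by force
  qed auto
  show thesis
  proof (rule that[of "sum K C"])
    fix z u assume z: "cmod z \<le> 1" and u: "inverse_pair (1 - z *\<^sub>C x) u"
    then obtain w where w: "w \<in> C" "z \<in> ball w (d w)"
      using C(3) by auto
    then have "norm u \<le> K w"
      using dK u C(1) by blast
    also have "K w \<le> sum K C"
      using w C dK by (intro member_le_sum) auto
    finally show "norm u \<le> sum K C" .
  qed
qed

text \<open>
  Suppose that the inverses of \<open>1 - t z x\<close> and of \<open>1 - z x\<close> differ by at most \<open>e\<close>, uniformly on the
  disc. Passing from \<open>x\<close> to its square replaces each inverse by the average of the inverses at the two
  square roots of \<open>z\<close>, and averaging preserves the bound. So the same \<open>e\<close> serves for all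
  iterated squares of \<open>x\<close>.
\<close>
lemma inverses_at_dilated_points_close:
  fixes x :: "'a::unital_cstar_algebra"
  assumes base: "\<And>z. cmod z \<le> 1 \<Longrightarrow> \<exists>u v. inverse_pair (1 - (complex_of_real t * z) *\<^sub>C x) u \<and>
      inverse_pair (1 - z *\<^sub>C x) v \<and> norm (u - v) \<le> e"
    and z: "cmod z \<le> 1"
  shows "\<exists>u v. inverse_pair (1 - (complex_of_real (t ^ 2 ^ m) * z) *\<^sub>C x ^ 2 ^ m) u \<and>
    inverse_pair (1 - z *\<^sub>C x ^ 2 ^ m) v \<and> norm (u - v) \<le> e"
  using z
proof (induction m arbitrary: z)
  case 0
  then show ?case using base by simp
next
  case (Suc m)
  let ?s = "complex_of_real (t ^ 2 ^ m)" and ?g = "x ^ 2 ^ m" and ?w = "csqrt z"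
  have w: "cmod ?w \<le> 1" "cmod (- ?w) \<le> 1"
    using Suc.prems by (simp_all add: norm_csqrt)
  have ww: "?w * ?w = z"
    using power2_csqrt[of z] by (simp only: power2_eq_square)
  have sq: "((a * ?w) *\<^sub>C ?g) * ((a * ?w) *\<^sub>C ?g) = (a * a * z) *\<^sub>C (?g * ?g)" for a
  proof -
    have "(a * ?w) * (a * ?w) = a * a * (?w * ?w)"
      by (simp only: mult_ac)
    then show ?thesis
      by (simp only: mult_scaleC_left mult_scaleC_right scaleC_scaleC ww)
  qed
  obtain u1 v1 where 1: "inverse_pair (1 - (?s * ?w) *\<^sub>C ?g) u1" "inverse_pair (1 - ?w *\<^sub>C ?g) v1"
      "norm (u1 - v1) \<le> e"
    using Suc.IH[OF w(1)] by blast
  obtain u2 v2 where 2: "inverse_pair (1 - (?s * - ?w) *\<^sub>C ?g) u2" "inverse_pair (1 - (- ?w) *\<^sub>C ?g) v2"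
      "norm (u2 - v2) \<le> e"
    using Suc.IH[OF w(2)] by blast
  have "inverse_pair (1 - (?s * ?s * z) *\<^sub>C (?g * ?g)) ((1/2) *\<^sub>R (u1 + u2))"
    using inverse_pair_average[of "(?s * ?w) *\<^sub>C ?g" u1 u2] 1 2 by (simp add: sq)
  moreover have "inverse_pair (1 - z *\<^sub>C (?g * ?g)) ((1/2) *\<^sub>R (v1 + v2))"
    using inverse_pair_average[of "(1 * ?w) *\<^sub>C ?g" v1 v2] 1 2 sq[of 1] by simp
  moreover have "norm ((1/2) *\<^sub>R (u1 + u2) - (1/2) *\<^sub>R (v1 + v2)) \<le> e"
  proof -
    have "(1/2) *\<^sub>R (u1 + u2) - (1/2) *\<^sub>R (v1 + v2) = (1/2) *\<^sub>R ((u1 - v1) + (u2 - v2))"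
      by (simp add: algebra_simps)
    then show ?thesis
      using norm_triangle_ineq[of "u1 - v1" "u2 - v2"] 1(3) 2(3) by simp
  qed
  moreover have "?g * ?g = x ^ 2 ^ Suc m" "?s * ?s = complex_of_real (t ^ 2 ^ Suc m)"
    by (simp_all add: mult_2 power_add)
  ultimately show ?case
    by (intro exI[of _ "(1/2) *\<^sub>R (u1 + u2)"] exI[of _ "(1/2) *\<^sub>R (v1 + v2)"]) simp
qed

text \<open>
  This replaces the spectral radius formula. If all \<open>1 - z x\<close> were invertible, then, for \<open>t < 1\<close> close
  to \<open>1\<close> and every iterated square \<open>g = x ^ 2 ^ m\<close>, the inverse of \<open>1 - g\<close> would be close to the
  inverse of \<open>1 - s g\<close>, where \<open>s = t ^ 2 ^ m\<close>. As \<open>m\<close> grows, \<open>s\<close> tends to \<open>0\<close>, so both inverses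
  would come close to \<open>1\<close>, which contradicts \<open>norm g = 1\<close>.
\<close>
lemma noninvertible_in_disc:
  fixes x :: "'a::unital_cstar_algebra"
  assumes x: "\<And>m. norm (x ^ 2 ^ m) = 1"
  shows "\<exists>z. cmod z \<le> 1 \<and> \<not> invertible_element (1 - z *\<^sub>C x)"
proof (rule ccontr)
  assume "\<not> ?thesis"
  then have inv: "\<And>z. cmod z \<le> 1 \<Longrightarrow> invertible_element (1 - z *\<^sub>C x)"
    by blast
  have nx: "norm x = 1"
    using x[of 0] by simp
  obtain M where M: "\<And>z u. cmod z \<le> 1 \<Longrightarrow> inverse_pair (1 - z *\<^sub>C x) u \<Longrightarrow> norm u \<le> M"
    using inverses_bounded_on_disc[OF inv] by blast
  \<comment> \<open>The inverses at \<open>t z\<close> and \<open>z\<close> differ by at most \<open>(1 - t) M\<^sup>2\<close>; this \<open>t\<close> makes that at most \<open>1/8\<close>.\<close>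
  define t where "t = 1 - 1 / (8 * (M\<^sup>2 + 1))"
  have M2: "0 \<le> M\<^sup>2" by simp
  then have M8: "1 < 8 * (M\<^sup>2 + 1)"
    unfolding distrib_left by linarith
  have t: "0 < t" "t < 1" and tM: "(1 - t) * M\<^sup>2 \<le> 1 / 8"
    using M8 by (simp_all add: t_def divide_simps)
  have base: "\<exists>u v. inverse_pair (1 - (complex_of_real t * z) *\<^sub>C x) u \<and>
      inverse_pair (1 - z *\<^sub>C x) v \<and> norm (u - v) \<le> 1 / 8" if z: "cmod z \<le> 1" for z
  proof -
    have tz: "cmod (complex_of_real t * z) \<le> 1"
      using t z by (simp add: norm_mult mult_le_one)
    obtain u v where u: "inverse_pair (1 - (complex_of_real t * z) *\<^sub>C x) u"
      and v: "inverse_pair (1 - z *\<^sub>C x) v"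
      using inv[OF z] inv[OF tz] by (auto simp: invertible_iff_inverse_pair)
    have "u - v = ((complex_of_real t - 1) * z) *\<^sub>C (u * x * v)"
      using inverse_pair_diff[OF u v]
      by (simp add: mult_scaleC_left mult_scaleC_right scaleC.scale_left_diff_distrib[symmetric]
          left_diff_distrib)
    then have "norm (u - v) = cmod (complex_of_real (t - 1) * z) * norm (u * x * v)"
      by (simp add: norm_scaleC)
    also have "\<dots> \<le> (1 - t) * (M * 1 * M)"
    proof (rule mult_mono)
      show "cmod (complex_of_real (t - 1) * z) \<le> 1 - t"
        using t z unfolding norm_mult norm_of_real by (simp add: mult_left_le)
      have "norm (u * x * v) \<le> norm u * norm x * norm v"
        by (rule norm_mult3_le)
      also have "\<dots> \<le> M * 1 * M"
        using M[OF tz u] M[OF z v] nx by (intro mult_mono) (auto intro: order_trans[OF norm_ge_zero])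
      finally show "norm (u * x * v) \<le> M * 1 * M" .
    qed (use t in auto)
    finally show ?thesis
      using u v tM by (intro exI[of _ u] exI[of _ v]) (simp add: power2_eq_square)
  qed
  obtain m where m: "t ^ m < 1 / 8"
    using real_arch_pow_inv[of "1/8" t] t by auto
  define s where "s = t ^ 2 ^ m"
  define g where "g = x ^ 2 ^ m"
  have s: "0 \<le> s" "s \<le> 1 / 8"
  proof -
    have "s \<le> t ^ m"
      unfolding s_def using t by (intro power_decreasing) (auto simp: less_imp_le)
    then show "s \<le> 1 / 8" using m by simp
  qed (use t in \<open>simp add: s_def\<close>)
  have g: "norm g = 1"
    using x by (simp add: g_def)
  obtain u v where u: "inverse_pair (1 - s *\<^sub>R g) u" and v: "inverse_pair (1 - g) v"
      and uv: "norm (u - v) \<le> 1 / 8"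
    using inverses_at_dilated_points_close[of t x "1/8" 1 m, OF base]
    by (auto simp: s_def g_def scaleC_of_real simp del: of_real_power)
  have "u - 1 = s *\<^sub>R (g * u)"
    using u by (simp add: inverse_pair_def algebra_simps)
  then have u1: "norm (u - 1) \<le> 1 / 8 * norm u"
    using norm_mult_ineq[of g u] g s mult_mono[of s "1/8" "norm (g * u)" "norm u"] by simp
  moreover have "norm u \<le> norm (u - 1) + 1"
    using norm_triangle_ineq[of "u - 1" 1] norm_one_le[where 'a = 'a] by simp
  ultimately have "norm (u - 1) \<le> 1 / 7"
    by simp
  then have v1: "norm (v - 1) \<le> 1 / 7 + 1 / 8"
    using uv norm_triangle_ineq4[of "u - 1" "u - v"] by simp
  have "g = (v - 1) - g * (v - 1)"
    using v by (simp add: inverse_pair_def algebra_simps)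
  then have "norm g \<le> norm (v - 1) + norm g * norm (v - 1)"
    using norm_triangle_ineq4[of "v - 1" "g * (v - 1)"] norm_mult_ineq[of g "v - 1"] by simp
  with g v1 show False
    by simp
qed

text \<open>
  The \<open>C\<^sup>*\<close>-identity says that squaring a self-adjoint element squares its norm.
\<close>
lemma norm_power_selfadjoint:
  assumes "star x = x"
  shows "norm (x ^ 2 ^ m) = norm (x::'a::unital_cstar_algebra) ^ 2 ^ m"
proof (induction m)
  case (Suc m)
  have "star (x ^ n) = x ^ n" for n
    by (induction n) (simp_all add: star_mult assms power_commutes)
  then have "norm (x ^ 2 ^ m * x ^ 2 ^ m) = (norm (x ^ 2 ^ m))\<^sup>2"
    using cstar_identity[of "x ^ 2 ^ m"] by simp
  with Suc show ?case
    by (simp add: mult_2 power_add power2_eq_square)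
qed simp

lemma spectral_value_of_large_modulus:
  fixes x :: "'a::unital_cstar_algebra"
  assumes x: "star x = x" and "x \<noteq> 0"
  shows "\<exists>l\<in>spectrum x. norm x \<le> cmod l"
proof -
  define y where "y = (1 / norm x) *\<^sub>R x"
  have y: "star y = y" "norm y = 1"
    using assms by (simp_all add: y_def star_scaleR)
  then obtain z where z: "cmod z \<le> 1" "\<not> invertible_element (1 - z *\<^sub>C y)"
    using noninvertible_in_disc[of y] by (auto simp: norm_power_selfadjoint)
  then have z0: "z \<noteq> 0"
    using invertible_one by auto
  define c where "c = z / complex_of_real (norm x)"
  have c0: "c \<noteq> 0"
    using z0 assms by (simp add: c_def)
  have "z *\<^sub>C y = c *\<^sub>C x"
    by (simp add: y_def c_def scaleR_scaleC)
  then have "1 - z *\<^sub>C y = (- c) *\<^sub>C (x - (1 / c) *\<^sub>C 1)"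
    using c0 by (simp add: scaleC.scale_right_diff_distrib)
  then have "1 / c \<in> spectrum x"
    using z(2) c0 invertible_scaleC[of "- c"] by (auto simp: spectrum_def)
  moreover have "norm x \<le> cmod (1 / c)"
    using z z0 assms by (simp add: c_def norm_divide field_simps)
  ultimately show ?thesis ..
qed

lemma norm_le_if_spectrum_bounded:
  fixes x :: "'a::unital_cstar_algebra"
  assumes "star x = x" "0 \<le> r" "\<And>l. l \<in> spectrum x \<Longrightarrow> cmod l \<le> r"
  shows "norm x \<le> r"
proof (cases "x = 0")
  case False
  then obtain l where "l \<in> spectrum x" "norm x \<le> cmod l"
    using spectral_value_of_large_modulus assms(1) by blast
  with assms(3) show ?thesis
    by force
qed (use assms in simp)


section \<open>The cone of positive elements\<close>

lemma positive_iff_spectrum: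
  "positive_element x \<longleftrightarrow> star x = x \<and> (\<forall>l\<in>spectrum x. 0 \<le> Re l)"
proof
  assume "positive_element x"
  then show "star x = x \<and> (\<forall>l\<in>spectrum x. 0 \<le> Re l)"
    by (auto simp: positive_element_def)
next
  assume r: "star x = x \<and> (\<forall>l\<in>spectrum x. 0 \<le> Re l)"
  have "l \<in> complex_of_real ` {0..}" if "l \<in> spectrum x" for l
  proof -
    have "l = complex_of_real (Re l)"
      using r that spectrum_selfadjoint_real[of x l] by (simp add: complex_eq_iff)
    then show ?thesis
      using r that by (intro image_eqI[of _ _ "Re l"]) auto
  qed
  with r show "positive_element x"
    by (auto simp: positive_element_def)
qed

lemma spectrum_minus: "l \<in> spectrum (- x) \<longleftrightarrow> - l \<in> spectrum x"
  using spectrum_scale[of "-1" l x] by simp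

lemma spectrum_of_real_minus:
  "l \<in> spectrum (t *\<^sub>R 1 - x) \<longleftrightarrow> complex_of_real t - l \<in> spectrum x"
  using spectrum_shift[of l "- x" "complex_of_real t"]
  by (simp add: scaleR_scaleC spectrum_minus)

lemma star_of_real_minus:
  fixes x :: "'a::unital_cstar_algebra"
  assumes "star x = x"
  shows "star (t *\<^sub>R 1 - x) = t *\<^sub>R 1 - x"
  by (simp add: star_diff star_scaleR assms)

text \<open>
  The spectrum of \<open>t - x\<close> is the reflection \<open>t - \<lambda>\<close> of that of \<open>x\<close>, and the norm of a self-adjoint element
  is bounded by the moduli of its spectral values. A norm condition, unlike a spectral one, is visibly
  compatible with sums and limits.
\<close>
lemma positive_iff_norm:
  fixes x :: "'a::unital_cstar_algebra"
  assumes x: "star x = x" and t: "norm x \<le> t"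
  shows "positive_element x \<longleftrightarrow> norm (t *\<^sub>R 1 - x) \<le> t"
proof
  assume pos: "positive_element x"
  show "norm (t *\<^sub>R 1 - x) \<le> t"
  proof (rule norm_le_if_spectrum_bounded)
    fix l assume "l \<in> spectrum (t *\<^sub>R 1 - x)"
    then have l: "complex_of_real t - l \<in> spectrum x"
      by (simp add: spectrum_of_real_minus)
    then have "cmod (complex_of_real t - l) \<le> t"
      using spectrum_norm_le t order_trans by blast
    then have "\<bar>t - Re l\<bar> \<le> t"
      using abs_Re_le_cmod[of "complex_of_real t - l"] by simp
    moreover have "0 \<le> t - Re l" "Im l = 0"
      using pos l spectrum_selfadjoint_real[OF x l] by (auto simp: positive_iff_spectrum)
    ultimately show "cmod l \<le> t"
      by (simp add: cmod_eq_Re)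
  qed (use x t order_trans[OF norm_ge_zero t] in \<open>auto simp: star_of_real_minus\<close>)
next
  assume n: "norm (t *\<^sub>R 1 - x) \<le> t"
  have "0 \<le> Re l" if l: "l \<in> spectrum x" for l
  proof -
    have "complex_of_real t - l \<in> spectrum (t *\<^sub>R 1 - x)"
      using l by (simp add: spectrum_of_real_minus)
    then have "cmod (complex_of_real t - l) \<le> t"
      using spectrum_norm_le n order_trans by blast
    then show ?thesis
      using abs_Re_le_cmod[of "complex_of_real t - l"] by simp
  qed
  with x show "positive_element x"
    by (simp add: positive_iff_spectrum)
qed

lemma positive_selfadjoint: "positive_element x \<Longrightarrow> star x = x"
  by (simp add: positive_element_def)

lemma positive_add:
  fixes x y :: "'a::unital_cstar_algebra"
  assumes "positive_element x" "positive_element y"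
  shows "positive_element (x + y)"
proof -
  have "norm (norm x *\<^sub>R 1 - x) \<le> norm x" "norm (norm y *\<^sub>R 1 - y) \<le> norm y"
    using assms positive_iff_norm[of x "norm x"] positive_iff_norm[of y "norm y"]
    by (auto simp: positive_selfadjoint)
  then have "norm ((norm x *\<^sub>R 1 - x) + (norm y *\<^sub>R 1 - y)) \<le> norm x + norm y"
    by (rule norm_triangle_mono)
  then have "norm ((norm x + norm y) *\<^sub>R 1 - (x + y)) \<le> norm x + norm y"
    by (simp add: scaleR_add_left algebra_simps)
  moreover have "star (x + y) = x + y"
    using assms by (simp add: positive_selfadjoint star_add)
  ultimately show ?thesis
    using positive_iff_norm norm_triangle_ineq by blast
qed

lemma positive_element_zero: "positive_element (0::'a::unital_cstar_algebra)"
proof -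
  have "Re l = 0" if "l \<in> spectrum (0::'a)" for l
    using spectrum_norm_le[OF that] by simp
  then show ?thesis
    by (simp add: positive_iff_spectrum)
qed

lemma positive_scaleR:
  assumes "0 \<le> r" "positive_element x"
  shows "positive_element (r *\<^sub>R x)"
proof (cases "r = 0")
  case False
  have "0 \<le> Re l" if "l \<in> spectrum (r *\<^sub>R x)" for l
  proof -
    have "l / complex_of_real r \<in> spectrum x"
      using that False spectrum_scale[of "complex_of_real r" l x] by (simp add: scaleR_scaleC)
    then have "0 \<le> Re (l / complex_of_real r)"
      using assms(2) by (auto simp: positive_iff_spectrum)
    then show ?thesis
      using False assms(1) by (simp add: zero_le_divide_iff)
  qed
  with assms show ?thesis
    by (simp add: positive_iff_spectrum star_scaleR)
qed (simp add: positive_element_zero)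

lemma positive_sum:
  "(\<And>i. i \<in> I \<Longrightarrow> positive_element (f i)) \<Longrightarrow> positive_element (\<Sum>i\<in>I. f i)"
  by (induction I rule: infinite_finite_induct) (simp_all add: positive_element_zero positive_add)

lemma positive_limit:
  fixes x :: "'a::unital_cstar_algebra"
  assumes X: "X \<longlonglongrightarrow> x" and pos: "\<And>n. positive_element (X n)"
  shows "positive_element x"
proof -
  have "(\<lambda>n. star (X n)) \<longlonglongrightarrow> star x"
    by (rule bounded_linear.tendsto[OF bounded_linear_star X])
  then have x: "star x = x"
    using X pos LIMSEQ_unique by (simp add: positive_selfadjoint)
  obtain t where t: "\<And>n. norm (X n) \<le> t"
    using X convergent_imp_Bseq[of X] by (auto simp: convergent_def Bseq_def)
  have "norm x \<le> t"
    by (rule tendsto_upperbound[OF tendsto_norm[OF X]]) (simp_all add: t)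
  moreover have "norm (t *\<^sub>R 1 - x) \<le> t"
  proof (rule tendsto_upperbound)
    show "(\<lambda>n. norm (t *\<^sub>R 1 - X n)) \<longlonglongrightarrow> norm (t *\<^sub>R 1 - x)"
      by (intro tendsto_intros X)
    show "\<forall>\<^sub>F n in sequentially. norm (t *\<^sub>R 1 - X n) \<le> t"
      using positive_iff_norm[OF positive_selfadjoint[OF pos] t] pos by simp
  qed simp
  ultimately show ?thesis
    using positive_iff_norm x by blast
qed

lemma positive_approx:
  fixes x :: "'a::unital_cstar_algebra"
  assumes "\<And>e. 0 < e \<Longrightarrow> \<exists>y. positive_element y \<and> norm (y - x) \<le> e"
  shows "positive_element x"
proof -
  have "\<forall>n. \<exists>y. positive_element y \<and> norm (y - x) \<le> 1 / real (Suc n)"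
    using assms by simp
  then obtain X where X: "\<And>n. positive_element (X n)" "\<And>n. norm (X n - x) \<le> 1 / real (Suc n)"
    by metis
  have "(\<lambda>n. X n - x) \<longlonglongrightarrow> 0"
    by (rule Lim_null_comparison[OF always_eventually LIMSEQ_Suc[OF lim_1_over_n]]) (use X in auto)
  then show ?thesis
    using positive_limit X(1) LIM_zero_cancel by blast
qed

lemma positive_antisym:
  fixes x :: "'a::unital_cstar_algebra"
  assumes "positive_element x" "positive_element (- x)"
  shows "x = 0"
proof -
  have "cmod l \<le> 0" if l: "l \<in> spectrum x" for l
  proof -
    have "0 \<le> Re l" "0 \<le> Re (- l)"
      using assms l by (auto simp only: positive_iff_spectrum spectrum_minus minus_minus)
    moreover have "Im l = 0"
      using spectrum_selfadjoint_real[OF positive_selfadjoint l] assms by blast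
    ultimately show ?thesis
      by (simp add: complex_eq_iff)
  qed
  then have "norm x \<le> 0"
    by (rule norm_le_if_spectrum_bounded[OF positive_selfadjoint[OF assms(1)] order_refl])
  then show ?thesis by simp
qed

lemma positive_norm_plus:
  fixes x :: "'a::unital_cstar_algebra"
  assumes "star x = x"
  shows "positive_element (norm x *\<^sub>R 1 + x)"
proof -
  have "0 \<le> Re l" if "l \<in> spectrum (norm x *\<^sub>R 1 + x)" for l
  proof -
    have "l - complex_of_real (norm x) \<in> spectrum x"
      using that spectrum_shift[of l x "complex_of_real (norm x)"] by (simp add: scaleR_scaleC add.commute)
    then have "cmod (l - complex_of_real (norm x)) \<le> norm x"
      by (rule spectrum_norm_le)
    then show ?thesis
      using abs_Re_le_cmod[of "l - complex_of_real (norm x)"] by simp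
  qed
  with assms show ?thesis
    by (simp add: positive_iff_spectrum star_add star_scaleR)
qed

text \<open>
  In this and the next two lemmas \<open>f\<close> is the real function given by a polynomial \<open>p\<close> with real
  coefficients, and \<open>I\<close> is any nonempty set of reals that contains the spectrum.
\<close>
lemma spectral_value_of_poly_at:
  assumes x: "star x = x" and sp: "\<And>t. complex_of_real t \<in> spectrum x \<Longrightarrow> t \<in> I" and I: "I \<noteq> {}"
    and p: "\<And>t. poly p (complex_of_real t) = complex_of_real (f t)"
    and l: "l \<in> spectrum (poly_at p x)"
  shows "\<exists>t\<in>I. l = complex_of_real (f t)"
proof -
  have "spectrum x \<subseteq> complex_of_real ` I"
  proof
    fix z assume z: "z \<in> spectrum x"
    then have "z = complex_of_real (Re z)"
      using spectrum_selfadjoint_real[OF x] by (simp add: complex_eq_iff)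
    with z sp[of "Re z"] show "z \<in> complex_of_real ` I"
      by auto
  qed
  then have "spectrum (poly_at p x) \<subseteq> poly p ` complex_of_real ` I"
    using I by (intro spectrum_poly_at_subset) auto
  with l obtain t where "t \<in> I" "l = poly p (complex_of_real t)"
    by blast
  with p show ?thesis
    by auto
qed

lemma positive_poly_at:
  assumes "star x = x" "\<And>t. complex_of_real t \<in> spectrum x \<Longrightarrow> t \<in> I" "I \<noteq> {}"
    and "\<And>t. poly p (complex_of_real t) = complex_of_real (f t)"
    and "\<And>t. t \<in> I \<Longrightarrow> 0 \<le> f t"
  shows "positive_element (poly_at p x)"
proof -
  have "0 \<le> Re l" if l: "l \<in> spectrum (poly_at p x)" for l
  proof -
    obtain t where "t \<in> I" "l = complex_of_real (f t)"
      using spectral_value_of_poly_at[OF assms(1-4) l] by blast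
    then show ?thesis
      using assms(5) by simp
  qed
  then show ?thesis
    using star_poly_at[OF assms(1,4)] by (simp add: positive_iff_spectrum)
qed

lemma norm_poly_at_le:
  fixes x :: "'a::unital_cstar_algebra"
  assumes "star x = x" "\<And>t. complex_of_real t \<in> spectrum x \<Longrightarrow> t \<in> I" "I \<noteq> {}"
    and "\<And>t. poly p (complex_of_real t) = complex_of_real (f t)"
    and "\<And>t. t \<in> I \<Longrightarrow> \<bar>f t\<bar> \<le> r"
  shows "norm (poly_at p x) \<le> r"
proof (rule norm_le_if_spectrum_bounded)
  show "star (poly_at p x) = poly_at p x"
    using star_poly_at[OF assms(1,4)] .
  show "0 \<le> r"
    using assms(3,5) by (meson abs_ge_zero all_not_in_conv order_trans)
  show "cmod l \<le> r" if "l \<in> spectrum (poly_at p x)" for l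
  proof -
    obtain t where "t \<in> I" "l = complex_of_real (f t)"
      using spectral_value_of_poly_at[OF assms(1-4) \<open>l \<in> _\<close>] by blast
    then show ?thesis
      using assms(5) by simp
  qed
qed

lemma positive_square:
  assumes "star x = x"
  shows "positive_element (x * x)"
  using positive_poly_at[of x UNIV "[:0, 0, 1:]" "\<lambda>t. t * t"] assms by simp

text \<open>
  If \<open>w\<close> inverts \<open>b a - \<lambda>\<close>, then \<open>(a w b - 1) / \<lambda>\<close> inverts \<open>a b - \<lambda>\<close>.
\<close>
lemma spectrum_mult_swap:
  fixes a b :: "'a::unital_cstar_algebra"
  assumes "l \<in> spectrum (a * b)" "l \<noteq> 0"
  shows "l \<in> spectrum (b * a)"
proof (rule ccontr)
  assume "l \<notin> spectrum (b * a)"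
  then obtain w where w: "(b * a - l *\<^sub>C 1) * w = 1" "w * (b * a - l *\<^sub>C 1) = 1"
    by (auto simp: spectrum_def invertible_element_def)
  have "(a * b - l *\<^sub>C 1) * (a * w * b - 1) = a * ((b * a - l *\<^sub>C 1) * w) * b - a * b + l *\<^sub>C 1"
    by (simp add: algebra_simps mult_scaleC_left mult_scaleC_right)
  then have 1: "(a * b - l *\<^sub>C 1) * (a * w * b - 1) = l *\<^sub>C 1"
    by (simp add: w)
  have "(a * w * b - 1) * (a * b - l *\<^sub>C 1) = a * (w * (b * a - l *\<^sub>C 1)) * b - a * b + l *\<^sub>C 1"
    by (simp add: algebra_simps mult_scaleC_left mult_scaleC_right)
  then have 2: "(a * w * b - 1) * (a * b - l *\<^sub>C 1) = l *\<^sub>C 1"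
    by (simp add: w)
  have "invertible_element (a * b - l *\<^sub>C 1)"
    unfolding invertible_element_def
    by (rule exI[of _ "inverse l *\<^sub>C (a * w * b - 1)"])
      (simp only: mult_scaleC_left mult_scaleC_right 1 2, simp add: assms(2))
  with assms(1) show False
    by (simp add: spectrum_def)
qed

text \<open>
  Let \<open>x = c\<^sup>* c\<close> have a negative spectral value \<open>\<lambda>\<close>, and put \<open>r = norm x\<close>. For
  \<open>d = c (1 - x / r)\<^sup>n\<close> one has \<open>d\<^sup>* d = x (1 - x / r)\<^sup>2\<^sup>n\<close>. The function \<open>t (1 - t / r)\<^sup>2\<^sup>n\<close> is at most
  \<open>r\<close> on \<open>[-r, r]\<close>, but below \<open>- r\<close> at \<open>\<lambda>\<close> once \<open>n\<close> is large. Now \<open>d d\<^sup>* + d\<^sup>* d\<close> is half the sum of the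
  squares of the self-adjoint elements \<open>d + d\<^sup>*\<close> and \<open>\<i> (d - d\<^sup>*)\<close>. So \<open>d\<^sup>* d \<le> r\<close> forces
  \<open>d d\<^sup>* \<ge> - r\<close>. But \<open>d\<^sup>* d\<close> and \<open>d d\<^sup>*\<close> have the same nonzero spectral values, and one of these is below \<open>- r\<close>.
\<close>
lemma positive_star_mult:
  fixes c :: "'a::unital_cstar_algebra"
  shows "positive_element (star c * c)"
proof (rule ccontr)
  define x where "x = star c * c"
  assume "\<not> positive_element (star c * c)"
  moreover have x: "star x = x"
    by (simp add: x_def star_mult star_star)
  ultimately obtain l where l: "l \<in> spectrum x" "Re l < 0"
    by (auto simp: positive_iff_spectrum x_def not_le)
  have lre: "l = complex_of_real (Re l)"
    using spectrum_selfadjoint_real[OF x l(1)] by (simp add: complex_eq_iff)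
  define r where "r = norm x"
  have "cmod l \<le> r"
    using spectrum_norm_le l(1) by (simp add: r_def)
  then have r: "0 < r"
    using l(2) abs_Re_le_cmod[of l] by linarith
  obtain n where n: "r / (- Re l) < (1 + (- Re l) / r) ^ n"
  proof -
    have "1 < 1 + (- Re l) / r"
      using l(2) r by (simp add: divide_neg_pos)
    then show ?thesis
      using real_arch_pow that by blast
  qed
  define f where "f t = (1 - t / r) ^ n" for t :: real
  define p where "p = [:1, complex_of_real (- 1 / r):] ^ n"
  have p: "poly p (complex_of_real t) = complex_of_real (f t)" for t
    by (simp add: p_def f_def)
  define q where "q = [:0, 1:] * (p * p)"
  have q: "poly q (complex_of_real t) = complex_of_real (t * (f t)\<^sup>2)" for t
    by (simp add: q_def p power2_eq_square)
  define d where "d = c * poly_at p x"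
  have dd: "star d * d = poly_at q x"
  proof -
    have "star d * d = poly_at p x * x * poly_at p x"
      using star_poly_at[OF x p] by (simp add: d_def star_mult x_def mult.assoc)
    also have "poly_at p x * x = x * poly_at p x"
      using poly_at_commute[of p x "[:0, 1:]"] by simp
    finally show ?thesis
      by (simp add: q_def poly_at_mult mult.assoc)
  qed
  have up: "positive_element (r *\<^sub>R 1 - star d * d)"
  proof -
    have "positive_element (poly_at ([:complex_of_real r:] - q) x)"
    proof (rule positive_poly_at[OF x, of "{-r..r}"])
      show "t \<in> {- r..r}" if "complex_of_real t \<in> spectrum x" for t
        using spectrum_norm_le[OF that] by (auto simp: r_def)
      show "poly ([:complex_of_real r:] - q) (complex_of_real t) = complex_of_real (r - t * (f t)\<^sup>2)" for t
        by (simp add: q)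
      show "0 \<le> r - t * (f t)\<^sup>2" if t: "t \<in> {- r..r}" for t
      proof (cases "t \<le> 0")
        case True
        then have "t * (f t)\<^sup>2 \<le> 0"
          by (simp add: mult_nonpos_nonneg)
        then show ?thesis using r by linarith
      next
        case False
        then have "(f t)\<^sup>2 \<le> 1"
          using t r by (simp add: f_def power_le_one)
        then have "t * (f t)\<^sup>2 \<le> r * 1"
          using False t by (intro mult_mono) auto
        then show ?thesis by simp
      qed
    qed (use r in auto)
    then show ?thesis
      by (simp add: poly_at_diff dd scaleC_of_real)
  qed
  have "positive_element (r *\<^sub>R 1 + d * star d)"
  proof -
    let ?s = "d + star d" and ?u = "\<i> *\<^sub>C (d - star d)"
    have "star ?s = ?s" "star ?u = ?u"
      by (simp_all add: star_add star_star star_scaleC star_diff scaleC.scale_right_diff_distrib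
          add.commute)
    then have "positive_element (?s * ?s + ?u * ?u)"
      by (intro positive_add positive_square)
    moreover have "?s * ?s + ?u * ?u = 2 *\<^sub>R (d * star d + star d * d)"
      by (simp add: mult_scaleC_left mult_scaleC_right algebra_simps scaleR_2)
    ultimately have "positive_element (2 *\<^sub>R (d * star d + star d * d))"
      by simp
    from positive_scaleR[of "1/2", OF _ this] have "positive_element (d * star d + star d * d)"
      by simp
    from positive_add[OF this up] show ?thesis
      by (simp add: add.commute)
  qed
  have "poly q l \<in> spectrum (star d * d)"
    unfolding dd using l(1) by (rule poly_in_spectrum_poly_at)
  then have mem: "complex_of_real (Re l * (f (Re l))\<^sup>2) \<in> spectrum (star d * d)"
    using q[of "Re l"] unfolding lre[symmetric] by simp
  have less: "Re l * (f (Re l))\<^sup>2 < - r"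
  proof -
    have f: "f (Re l) = (1 + (- Re l) / r) ^ n"
      by (simp add: f_def)
    then have "1 \<le> f (Re l)"
      using l(2) r by (simp add: divide_nonpos_pos)
    then have "f (Re l) \<le> (f (Re l))\<^sup>2"
      by (simp add: power2_eq_square)
    with n f have "r / (- Re l) < (f (Re l))\<^sup>2"
      by linarith
    then have "r < (f (Re l))\<^sup>2 * (- Re l)"
      using l(2) by (subst (asm) pos_divide_less_eq) auto
    then show ?thesis
      by (simp add: mult.commute)
  qed
  have "complex_of_real (Re l * (f (Re l))\<^sup>2) \<noteq> 0"
    unfolding of_real_eq_0_iff using less r by linarith
  then have "complex_of_real (Re l * (f (Re l))\<^sup>2) \<in> spectrum (d * star d)"
    by (rule spectrum_mult_swap[OF mem])
  then have "complex_of_real (r + Re l * (f (Re l))\<^sup>2) \<in> spectrum (r *\<^sub>R 1 + d * star d)"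
    using spectrum_shift[of "complex_of_real (r + Re l * (f (Re l))\<^sup>2)" "d * star d" "complex_of_real r"]
    by (simp add: scaleR_scaleC add.commute)
  with \<open>positive_element (r *\<^sub>R 1 + d * star d)\<close> have "0 \<le> r + Re l * (f (Re l))\<^sup>2"
    unfolding positive_iff_spectrum by (metis Re_complex_of_real)
  with less show False
    by simp
qed

text \<open>
  If \<open>q\<close> had a self-adjoint square root \<open>b\<close>, then \<open>w\<^sup>* q w\<close> would be \<open>(b w)\<^sup>* (b w)\<close>. An approximate square
  root is enough since the cone is closed; Weierstrass approximation of the function \<open>sqrt\<close> on the interval
  \<open>[0, norm q]\<close> gives one that is a polynomial in \<open>q\<close>.
\<close>
lemma positive_sandwich:
  fixes q w :: "'a::unital_cstar_algebra"
  assumes q: "positive_element q"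
  shows "positive_element (star w * q * w)"
proof (rule positive_approx)
  fix e :: real assume e: "0 < e"
  have qs: "star q = q"
    using q by (rule positive_selfadjoint)
  define t where "t = norm q"
  have sp: "s \<in> {0..t}" if "complex_of_real s \<in> spectrum q" for s
  proof -
    have "0 \<le> Re (complex_of_real s)"
      using q that by (simp only: positive_iff_spectrum)
    then show ?thesis
      using spectrum_norm_le[OF that] by (simp add: t_def)
  qed
  have t: "0 \<le> t"
    by (simp add: t_def)
  \<comment> \<open>On \<open>[0, t]\<close> an error of \<open>k \<le> 1\<close> in the square root is an error of at most \<open>k (2 sqrt t + 1)\<close> in its
    square, and multiplying by \<open>w\<close> on both sides costs a factor \<open>(norm w)\<^sup>2\<close>.\<close>
  define e' where "e' = e / ((norm w)\<^sup>2 + 1)"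
  have w1: "0 < (norm w)\<^sup>2 + 1"
    by (simp add: add_nonneg_pos)
  then have e': "0 < e'"
    using e by (simp add: e'_def)
  define k where "k = min 1 (e' / (2 * sqrt t + 1))"
  have t1: "0 < 2 * sqrt t + 1"
    using t by (simp add: add_nonneg_pos)
  have k: "0 < k" "k \<le> 1" "k * (2 * sqrt t + 1) \<le> e'"
  proof -
    show "0 < k" "k \<le> 1"
      using e' t1 by (simp_all add: k_def)
    have "k \<le> e' / (2 * sqrt t + 1)"
      by (simp add: k_def)
    then show "k * (2 * sqrt t + 1) \<le> e'"
      using t1 by (simp add: pos_le_divide_eq)
  qed
  obtain g where "real_polynomial_function g" and g: "\<And>s. s \<in> {0..t} \<Longrightarrow> \<bar>sqrt s - g s\<bar> < k"
    by (rule Stone_Weierstrass_real_polynomial_function[of "{0..t}" sqrt k])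
      (use k in \<open>auto intro!: continuous_intros\<close>)
  then obtain a n where an: "g = (\<lambda>s. \<Sum>i\<le>n. a i * s ^ i)"
    unfolding real_polynomial_function_iff_sum by blast
  define p where "p = (\<Sum>i\<le>n. monom (complex_of_real (a i)) i)"
  have p: "poly p (complex_of_real s) = complex_of_real (g s)" for s
    by (simp add: p_def an poly_sum poly_monom)
  define b where "b = poly_at p q"
  have b: "star b = b"
    unfolding b_def by (rule star_poly_at[OF qs p])
  have "norm (poly_at (p * p - [:0, 1:]) q) \<le> e'"
  proof (rule norm_poly_at_le[OF qs sp])
    show "poly (p * p - [:0, 1:]) (complex_of_real s) = complex_of_real (g s * g s - s)" for s
      by (simp add: p)
    fix s assume s: "s \<in> {0..t}"
    have "g s * g s - s = (g s - sqrt s) * (g s + sqrt s)"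
      using s by (simp add: algebra_simps)
    then have "\<bar>g s * g s - s\<bar> = \<bar>sqrt s - g s\<bar> * \<bar>g s + sqrt s\<bar>"
      by (simp add: abs_mult abs_minus_commute)
    also have "\<dots> \<le> k * (2 * sqrt t + 1)"
    proof (rule mult_mono)
      have "0 \<le> sqrt s" "sqrt s \<le> sqrt t"
        using s by auto
      then show "\<bar>g s + sqrt s\<bar> \<le> 2 * sqrt t + 1"
        using g[OF s] k(2) unfolding abs_le_iff abs_less_iff by linarith
    qed (use g[OF s] k in auto)
    finally show "\<bar>g s * g s - s\<bar> \<le> e'"
      using k(3) by linarith
  qed (use t in auto)
  then have near: "norm (b * b - q) \<le> e'"
    by (simp add: poly_at_diff poly_at_mult b_def)
  have "norm (star (b * w) * (b * w) - star w * q * w) \<le> e"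
  proof -
    have "star (b * w) * (b * w) - star w * q * w = star w * (b * b - q) * w"
      by (simp add: star_mult b algebra_simps)
    then have "norm (star (b * w) * (b * w) - star w * q * w) \<le> norm w * norm (b * b - q) * norm w"
      using norm_mult3_le[of "star w" "b * b - q" w] by (simp add: norm_star)
    also have "\<dots> = norm (b * b - q) * (norm w)\<^sup>2"
      by (simp add: power2_eq_square)
    also have "\<dots> \<le> e' * ((norm w)\<^sup>2 + 1)"
      using near e' by (intro mult_mono) auto
    also have "\<dots> = e"
      using w1 by (simp add: e'_def)
    finally show ?thesis .
  qed
  then show "\<exists>y. positive_element y \<and> norm (y - star w * q * w) \<le> e"
    using positive_star_mult by blast
qed


section \<open>Kadison's inequality\<close>

locale unital_positive_map =
  fixes \<Phi> :: "'a::unital_cstar_algebra \<Rightarrow> 'b::unital_cstar_algebra"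
  assumes linear: "Vector_Spaces.linear scaleC scaleC \<Phi>"
    and positive: "positive_map \<Phi>"
    and unital: "unital_map \<Phi>"
begin

lemma map_one [simp]: "\<Phi> 1 = 1"
  using unital by (simp add: unital_map_def)

lemma map_add: "\<Phi> (x + y) = \<Phi> x + \<Phi> y"
  using linear by (simp add: Vector_Spaces.linear_def module_hom_def module_hom_axioms_def)

lemma map_scaleC: "\<Phi> (c *\<^sub>C x) = c *\<^sub>C \<Phi> x"
  using linear by (simp add: Vector_Spaces.linear_def module_hom_def module_hom_axioms_def)

lemma map_scaleR: "\<Phi> (r *\<^sub>R x) = r *\<^sub>R \<Phi> x"
  by (simp add: scaleR_scaleC map_scaleC)

lemma map_minus: "\<Phi> (- x) = - \<Phi> x"
  using map_scaleR[of "-1" x] by simp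

lemma map_diff: "\<Phi> (x - y) = \<Phi> x - \<Phi> y"
  using map_add[of x "- y"] by (simp add: map_minus)

lemma map_zero: "\<Phi> 0 = 0"
  using map_scaleR[of 0 0] by simp

lemma map_sum: "\<Phi> (\<Sum>i\<in>I. f i) = (\<Sum>i\<in>I. \<Phi> (f i))"
  by (induction I rule: infinite_finite_induct) (simp_all add: map_zero map_add)

lemma map_positive: "positive_element x \<Longrightarrow> positive_element (\<Phi> x)"
  using positive by (simp add: positive_map_def)

lemma map_norm_plus:
  assumes "star x = x"
  shows "positive_element (norm x *\<^sub>R 1 + \<Phi> x)"
  using map_positive[OF positive_norm_plus[OF assms]] by (simp add: map_add map_scaleR)

lemma map_selfadjoint:
  assumes "star x = x"
  shows "star (\<Phi> x) = \<Phi> x"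
  using positive_selfadjoint[OF map_norm_plus[OF assms]] by (simp add: star_add star_scaleR)

text \<open>
  Both \<open>norm x + \<Phi> x\<close> and \<open>norm x - \<Phi> x\<close> are images of positive elements.
\<close>
lemma map_norm_le_selfadjoint:
  assumes x: "star x = x"
  shows "norm (\<Phi> x) \<le> norm x"
proof (rule norm_le_if_spectrum_bounded)
  show sa: "star (\<Phi> x) = \<Phi> x"
    by (rule map_selfadjoint[OF x])
  fix l assume l: "l \<in> spectrum (\<Phi> x)"
  let ?t = "complex_of_real (norm x)"
  have "?t + l \<in> spectrum (norm x *\<^sub>R 1 + \<Phi> x)"
    using l spectrum_shift[of "?t + l" "\<Phi> x" ?t] by (simp add: scaleR_scaleC add.commute)
  then have "0 \<le> Re (?t + l)"
    using map_norm_plus[OF x] unfolding positive_iff_spectrum by blast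
  moreover have "?t - l \<in> spectrum (norm x *\<^sub>R 1 + \<Phi> (- x))"
    using l by (simp add: map_minus spectrum_of_real_minus)
  then have "0 \<le> Re (?t - l)"
    using map_norm_plus[of "- x"] x unfolding positive_iff_spectrum star_minus norm_minus_cancel
    by (metis (no_types))
  moreover have "Im l = 0"
    by (rule spectrum_selfadjoint_real[OF sa l])
  ultimately show "cmod l \<le> norm x"
    by (simp add: cmod_eq_Re)
qed simp

end

lemma cartesian_decomposition:
  fixes x :: "'a::unital_cstar_algebra"
  obtains h k where "star h = h" "star k = k" "x = h + \<i> *\<^sub>C k" "norm h \<le> norm x" "norm k \<le> norm x"
proof
  let ?h = "(1/2) *\<^sub>R (x + star x)" and ?k = "(1/2) *\<^sub>R ((- \<i>) *\<^sub>C (x - star x))"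
  show "star ?h = ?h"
    by (simp add: star_scaleR star_add star_star add.commute)
  show "star ?k = ?k"
    by (simp add: star_scaleR star_scaleC star_diff star_minus star_star scaleC.scale_right_diff_distrib)
  have "x = (1/2) *\<^sub>R (x + star x) + (1/2) *\<^sub>R (x - star x)"
    by (simp add: algebra_simps flip: scaleR_add_left)
  then show "x = ?h + \<i> *\<^sub>C ?k"
    by (simp only: scaleC_scaleR_commute scaleC_scaleC) simp
  show "norm ?h \<le> norm x"
    using norm_triangle_ineq[of x "star x"] by (simp add: norm_star)
  have "norm ((- \<i>) *\<^sub>C (x - star x)) = norm (x - star x)"
    by (simp only: norm_scaleC) simp
  then show "norm ?k \<le> norm x"
    using norm_triangle_ineq4[of x "star x"] by (simp add: norm_star)
qed

definition bernstein_poly :: "nat \<Rightarrow> nat \<Rightarrow> complex poly" where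
  "bernstein_poly n k = smult (of_nat (n choose k)) ([:0, 1:] ^ k * [:1, - 1:] ^ (n - k))"

lemma poly_bernstein_poly:
  "poly (bernstein_poly n k) (complex_of_real t) = complex_of_real (Bernstein n k t)"
  by (simp add: bernstein_poly_def Bernstein_def)

lemma sum_bernstein_poly: "(\<Sum>k\<le>n. bernstein_poly n k) = 1"
  by (rule poly_eq_if_eq_on_reals)
    (simp add: poly_sum poly_bernstein_poly sum_Bernstein flip: of_real_sum)

lemma sum_k_bernstein_poly:
  assumes "0 < n"
  shows "(\<Sum>k\<le>n. smult (complex_of_real (k / n)) (bernstein_poly n k)) = [:0, 1:]"
proof (rule poly_eq_if_eq_on_reals)
  fix t :: real
  have "(\<Sum>k\<le>n. k / n * Bernstein n k t) = (\<Sum>k\<le>n. k * Bernstein n k t) / n"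
    by (simp only: sum_divide_distrib times_divide_eq_left)
  also have "\<dots> = t"
    unfolding sum_k_Bernstein using assms by simp
  finally show "poly (\<Sum>k\<le>n. smult (complex_of_real (k / n)) (bernstein_poly n k)) (complex_of_real t) =
      poly [:0, 1:] (complex_of_real t)"
    by (simp only: poly_sum poly_smult poly_bernstein_poly flip: of_real_mult of_real_sum) simp
qed

lemma sum_kk_bernstein_poly:
  assumes "0 < n"
  shows "(\<Sum>k\<le>n. smult (complex_of_real ((k / n)\<^sup>2)) (bernstein_poly n k)) =
    [:0, 0, 1:] + smult (complex_of_real (1 / n)) ([:0, 1:] - [:0, 0, 1:])"
proof (rule poly_eq_if_eq_on_reals)
  fix t :: real
  have "(\<Sum>k\<le>n. (k / n)\<^sup>2 * Bernstein n k t) =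
      (\<Sum>k\<le>n. (real k * (real k - 1) * Bernstein n k t + k * Bernstein n k t) / (real n)\<^sup>2)"
    by (rule sum.cong) (simp_all add: power2_eq_square algebra_simps add_divide_distrib)
  also have "\<dots> = (real n * (real n - 1) * t\<^sup>2 + n * t) / (real n)\<^sup>2"
    by (simp add: sum.distrib flip: sum_divide_distrib)
  also have "\<dots> = t * t + 1 / n * (t - t * t)"
    using assms by (simp add: field_simps power2_eq_square)
  finally show "poly (\<Sum>k\<le>n. smult (complex_of_real ((k / n)\<^sup>2)) (bernstein_poly n k)) (complex_of_real t) =
      poly ([:0, 0, 1:] + smult (complex_of_real (1 / n)) ([:0, 1:] - [:0, 0, 1:])) (complex_of_real t)"
    by (simp only: poly_sum poly_smult poly_bernstein_poly flip: of_real_mult of_real_sum)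
      (simp add: diff_divide_distrib algebra_simps)
qed

context unital_positive_map
begin

text \<open>
  For \<open>0 \<le> x \<le> 1\<close> the Bernstein polynomials of degree \<open>n\<close> give positive elements \<open>p\<^sub>k\<close> with
  \<open>\<Sum>p\<^sub>k = 1\<close>, \<open>\<Sum>\<lambda>\<^sub>k p\<^sub>k = x\<close> and \<open>\<Sum>\<lambda>\<^sub>k\<^sup>2 p\<^sub>k = x\<^sup>2 + (x - x\<^sup>2) / n\<close>, where \<open>\<lambda>\<^sub>k = k / n\<close>. They stand
  in for spectral projections. With \<open>y = \<Phi> x\<close>, expanding the positive element
  \<open>\<Sum>(\<lambda>\<^sub>k - y) \<Phi>(p\<^sub>k) (\<lambda>\<^sub>k - y)\<close> gives \<open>\<Phi> (x\<^sup>2) - y\<^sup>2\<close> up to an error of order \<open>1 / n\<close>.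
\<close>
lemma kadison_approximate:
  assumes x: "star x = x" and sp: "\<And>t. complex_of_real t \<in> spectrum x \<Longrightarrow> t \<in> {0..1}" and n: "0 < n"
  shows "positive_element (\<Phi> (x * x) - \<Phi> x * \<Phi> x + (1 / real n) *\<^sub>R \<Phi> (x - x * x))"
proof -
  define q where "q k = \<Phi> (poly_at (bernstein_poly n k) x)" for k
  have q: "positive_element (q k)" for k
    unfolding q_def
    by (intro map_positive positive_poly_at[OF x sp _ poly_bernstein_poly])
      (auto intro: Bernstein_nonneg)
  have q0: "(\<Sum>k\<le>n. q k) = 1"
    unfolding q_def map_sum[symmetric] poly_at_sum[symmetric] sum_bernstein_poly by simp
  have sm: "(\<Sum>k\<le>n. c k *\<^sub>R q k) = \<Phi> (poly_at (\<Sum>k\<le>n. smult (complex_of_real (c k)) (bernstein_poly n k)) x)" for c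
    by (simp add: q_def poly_at_sum poly_at_smult map_sum scaleC_of_real map_scaleR)
  have q1: "(\<Sum>k\<le>n. (k / n) *\<^sub>R q k) = \<Phi> x"
    unfolding sm sum_k_bernstein_poly[OF n] by simp
  have q2: "(\<Sum>k\<le>n. ((k / n)\<^sup>2) *\<^sub>R q k) = \<Phi> (x * x) + (1 / real n) *\<^sub>R \<Phi> (x - x * x)"
    unfolding sm sum_kk_bernstein_poly[OF n] poly_at_add poly_at_smult poly_at_diff
    by (simp add: map_add map_scaleR scaleC_of_real del: of_real_divide)
  let ?y = "\<Phi> x"
  have y: "star ?y = ?y"
    by (rule map_selfadjoint[OF x])
  let ?d = "\<lambda>k. (k / n) *\<^sub>R 1 - ?y"
  have "positive_element (\<Sum>k\<le>n. ?d k * q k * ?d k)"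
    using positive_sandwich[OF q, of "?d _"] unfolding star_of_real_minus[OF y] by (intro positive_sum)
  also have "(\<Sum>k\<le>n. ?d k * q k * ?d k) =
      (\<Sum>k\<le>n. ((k / n)\<^sup>2) *\<^sub>R q k - (k / n) *\<^sub>R q k * ?y - ?y * ((k / n) *\<^sub>R q k) + ?y * q k * ?y)"
    by (rule sum.cong) (simp_all add: algebra_simps power2_eq_square)
  also have "\<dots> = (\<Sum>k\<le>n. ((k / n)\<^sup>2) *\<^sub>R q k) - (\<Sum>k\<le>n. (k / n) *\<^sub>R q k) * ?y
      - ?y * (\<Sum>k\<le>n. (k / n) *\<^sub>R q k) + ?y * (\<Sum>k\<le>n. q k) * ?y"
    by (simp only: sum.distrib sum_subtractf sum_distrib_left sum_distrib_right)
  also have "\<dots> = \<Phi> (x * x) - ?y * ?y + (1 / real n) *\<^sub>R \<Phi> (x - x * x)"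
    unfolding q0 q1 q2 by simp
  finally show ?thesis .
qed

lemma kadison_unit_interval:
  assumes x: "star x = x" and sp: "\<And>t. complex_of_real t \<in> spectrum x \<Longrightarrow> t \<in> {0..1}"
  shows "positive_element (\<Phi> (x * x) - \<Phi> x * \<Phi> x)"
proof (rule positive_limit)
  show "positive_element (\<Phi> (x * x) - \<Phi> x * \<Phi> x + (1 / real (Suc n)) *\<^sub>R \<Phi> (x - x * x))" for n
    by (rule kadison_approximate[OF x sp]) auto
  have "(\<lambda>n. \<Phi> (x * x) - \<Phi> x * \<Phi> x + (1 / real (Suc n)) *\<^sub>R \<Phi> (x - x * x))
      \<longlonglongrightarrow> \<Phi> (x * x) - \<Phi> x * \<Phi> x + 0 *\<^sub>R \<Phi> (x - x * x)"
    by (intro tendsto_intros LIMSEQ_Suc[OF lim_1_over_n])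
  then show "(\<lambda>n. \<Phi> (x * x) - \<Phi> x * \<Phi> x + (1 / real (Suc n)) *\<^sub>R \<Phi> (x - x * x))
      \<longlonglongrightarrow> \<Phi> (x * x) - \<Phi> x * \<Phi> x"
    by simp
qed

text \<open>
  An affine substitution reduces the general case to \<open>0 \<le> x \<le> 1\<close>, since it only rescales
  \<open>\<Phi> (x\<^sup>2) - (\<Phi> x)\<^sup>2\<close>.
\<close>
theorem kadison_inequality:
  assumes x: "star x = x"
  shows "positive_element (\<Phi> (x * x) - \<Phi> x * \<Phi> x)"
proof -
  define r where "r = norm x + 1"
  have r: "0 < r"
    by (simp add: r_def add_nonneg_pos)
  define u where "u = (1 / (2 * r)) *\<^sub>R (x + r *\<^sub>R 1)"
  have u: "star u = u"
    by (simp add: u_def star_add star_scaleR x)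
  have "t \<in> {0..1}" if t: "complex_of_real t \<in> spectrum u" for t
  proof -
    define c where "c = complex_of_real (1 / (2 * r))"
    have c: "c \<noteq> 0"
      using r by (simp add: c_def)
    have "u = c *\<^sub>C (x + complex_of_real r *\<^sub>C 1)"
      by (simp only: u_def c_def scaleR_scaleC)
    with t have "complex_of_real t / c - complex_of_real r \<in> spectrum x"
      by (simp only: spectrum_scale[OF c] spectrum_shift)
    moreover have "complex_of_real t / c - complex_of_real r = complex_of_real (2 * r * t - r)"
      by (simp add: c_def)
    ultimately have "complex_of_real (2 * r * t - r) \<in> spectrum x"
      by simp
    then have "cmod (complex_of_real (2 * r * t - r)) \<le> norm x"
      by (rule spectrum_norm_le)
    then have "\<bar>2 * r * t - r\<bar> \<le> r"
      unfolding norm_of_real by (simp add: r_def)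
    then have "0 \<le> r * t" "r * t \<le> r"
      by linarith+
    then show ?thesis
      using r by (simp add: zero_le_mult_iff)
  qed
  then have pos: "positive_element (\<Phi> (u * u) - \<Phi> u * \<Phi> u)"
    by (rule kadison_unit_interval[OF u])
  have xu: "x = (2 * r) *\<^sub>R u - r *\<^sub>R 1"
    using r by (simp add: u_def)
  have "\<Phi> (x * x) - \<Phi> x * \<Phi> x = ((2 * r) * (2 * r)) *\<^sub>R (\<Phi> (u * u) - \<Phi> u * \<Phi> u)"
    unfolding xu by (simp add: algebra_simps map_add map_diff map_scaleR)
  with pos r show ?thesis
    by (simp add: positive_scaleR)
qed

text \<open>
  Apply Kadison's inequality to \<open>c + t h\<close>. As \<open>h\<close> gives equality, the term in \<open>t\<^sup>2\<close> vanishes, so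
  \<open>\<Phi> (c\<^sup>2) - (\<Phi> c)\<^sup>2 + t L\<close> is positive, where \<open>L\<close> is the element of the claim. Divide by \<open>t\<close> and let it
  tend to infinity.
\<close>
lemma jordan_multiplicative_positive:
  assumes h: "star h = h" and eq: "\<Phi> (h * h) = \<Phi> h * \<Phi> h" and c: "star c = c"
  shows "positive_element (\<Phi> (h * c + c * h) - (\<Phi> h * \<Phi> c + \<Phi> c * \<Phi> h))"
proof (rule positive_limit)
  let ?D = "\<Phi> (c * c) - \<Phi> c * \<Phi> c"
  let ?L = "\<Phi> (h * c + c * h) - (\<Phi> h * \<Phi> c + \<Phi> c * \<Phi> h)"
  show "positive_element ((1 / real (Suc n)) *\<^sub>R ?D + ?L)" for n
  proof -
    define t where "t = real (Suc n)"
    define x where "x = c + t *\<^sub>R h"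
    have "star x = x"
      by (simp add: x_def star_add star_scaleR h c)
    then have "positive_element ((1 / t) *\<^sub>R (\<Phi> (x * x) - \<Phi> x * \<Phi> x))"
      by (intro positive_scaleR kadison_inequality) (simp_all add: t_def)
    also have "\<Phi> (x * x) - \<Phi> x * \<Phi> x = ?D + t *\<^sub>R ?L"
      by (simp add: x_def distrib_left distrib_right map_add map_scaleR eq algebra_simps)
    also have "(1 / t) *\<^sub>R (?D + t *\<^sub>R ?L) = (1 / t) *\<^sub>R ?D + ?L"
      by (simp add: scaleR_add_right t_def)
    finally show ?thesis
      by (simp add: t_def)
  qed
  have "(\<lambda>n. (1 / real (Suc n)) *\<^sub>R ?D + ?L) \<longlonglongrightarrow> 0 *\<^sub>R ?D + ?L"
    by (intro tendsto_intros LIMSEQ_Suc[OF lim_1_over_n])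
  then show "(\<lambda>n. (1 / real (Suc n)) *\<^sub>R ?D + ?L) \<longlonglongrightarrow> ?L"
    by simp
qed

text \<open>
  For self-adjoint \<open>x\<close> the difference of the two sides is positive, and so is its negative because \<open>x\<close> may be
  replaced by \<open>- x\<close>. The general case is complex linearity.
\<close>
theorem jordan_multiplicative:
  assumes h: "star h = h" and eq: "\<Phi> (h * h) = \<Phi> h * \<Phi> h"
  shows "\<Phi> (h * x + x * h) = \<Phi> h * \<Phi> x + \<Phi> x * \<Phi> h"
proof -
  have sa: "\<Phi> (h * c + c * h) = \<Phi> h * \<Phi> c + \<Phi> c * \<Phi> h" if c: "star c = c" for c
  proof -
    let ?L = "\<lambda>c. \<Phi> (h * c + c * h) - (\<Phi> h * \<Phi> c + \<Phi> c * \<Phi> h)"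
    have "?L (- c) = - ?L c"
      by (simp add: map_add map_minus map_diff algebra_simps)
    moreover have "positive_element (?L (- c))"
      using jordan_multiplicative_positive[OF h eq, of "- c"] c by (simp add: star_minus)
    ultimately have "?L c = 0"
      using jordan_multiplicative_positive[OF h eq c] by (intro positive_antisym) simp_all
    then show ?thesis by simp
  qed
  obtain c d where cd: "star c = c" "star d = d" "x = c + \<i> *\<^sub>C d"
    using cartesian_decomposition by blast
  have "h * x + x * h = (h * c + c * h) + \<i> *\<^sub>C (h * d + d * h)"
    by (simp add: cd(3) distrib_left distrib_right scaleC_add_right mult_scaleC_left mult_scaleC_right add_ac)
  then have "\<Phi> (h * x + x * h) = (\<Phi> h * \<Phi> c + \<Phi> c * \<Phi> h) + \<i> *\<^sub>C (\<Phi> h * \<Phi> d + \<Phi> d * \<Phi> h)"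
    by (simp add: map_add[of "h * c + c * h"] map_scaleC sa cd)
  then show ?thesis
    by (simp add: cd(3) map_add map_scaleC distrib_left distrib_right scaleC_add_right
        mult_scaleC_left mult_scaleC_right add_ac)
qed

lemma map_star: "\<Phi> (star x) = star (\<Phi> x)"
proof -
  obtain h k where hk: "star h = h" "star k = k" "x = h + \<i> *\<^sub>C k"
    using cartesian_decomposition by blast
  then show ?thesis
    by (simp add: map_add map_scaleC star_add star_scaleC map_selfadjoint map_minus map_diff)
qed

lemma bounded_linear_map: "bounded_linear \<Phi>"
proof (rule bounded_linear_intro[where K = 2])
  fix x :: 'a
  obtain h k where hk: "star h = h" "star k = k" "x = h + \<i> *\<^sub>C k" "norm h \<le> norm x" "norm k \<le> norm x"
    using cartesian_decomposition by blast
  have "norm (\<Phi> x) \<le> norm (\<Phi> h) + norm (\<i> *\<^sub>C \<Phi> k)"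
    by (simp add: hk(3) map_add map_scaleC norm_triangle_ineq)
  also have "\<dots> \<le> norm h + norm k"
    using map_norm_le_selfadjoint hk by (simp add: norm_scaleC add_mono)
  also have "\<dots> \<le> norm x * 2"
    using hk by simp
  finally show "norm (\<Phi> x) \<le> norm x * 2" .
qed (simp_all add: map_add map_scaleR)

end


section \<open>Fixed points of unital positive maps\<close>

lemma in_cstar_generated: "x \<in> S \<Longrightarrow> x \<in> cstar_generated S"
  by (auto simp: cstar_generated_def)

lemma star_mult_in_cstar_generated:
  "x \<in> cstar_generated S \<Longrightarrow> y \<in> cstar_generated S \<Longrightarrow> star x * y \<in> cstar_generated S"
  by (auto simp: cstar_generated_def cstar_subalgebra_def)

text \<open>
  The fixed points of a positive map need not form an algebra. The elements that, together with their
  adjoints, multiply a closed subspace of fixed points into itself do form one, and they are fixed points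
  themselves when \<open>1\<close> lies in that subspace.
\<close>
lemma cstar_subalgebra_multipliers:
  fixes J :: "'a::unital_cstar_algebra set"
  assumes "module.subspace scaleC J" "closed J"
  shows "cstar_subalgebra {b. \<forall>x\<in>J. b * x \<in> J \<and> star b * x \<in> J}" (is "cstar_subalgebra ?B")
  unfolding cstar_subalgebra_def
proof (intro conjI ballI)
  show "module.subspace scaleC ?B"
    using assms(1)
    by (auto simp: scaleC.subspace_def star_add star_scaleC distrib_right mult_scaleC_left)
  have "?B = (\<Inter>x\<in>J. (\<lambda>b. b * x) -` J \<inter> (\<lambda>b. star b * x) -` J)"
    by auto
  moreover have "closed ((\<lambda>b. b * x) -` J)" "closed ((\<lambda>b. star b * x) -` J)" for x
    using assms(2)
    by (auto intro!: closed_vimage continuous_intros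
        bounded_linear.continuous_on[OF bounded_linear_star continuous_on_id])
  ultimately show "closed ?B"
    by (simp only:) (intro closed_INT closed_Int ballI)
  show "x * y \<in> ?B" "star x \<in> ?B" if "x \<in> ?B" "y \<in> ?B" for x y
    using that by (auto simp: star_mult star_star mult.assoc)
qed

lemma fixed_jordan_factor:
  assumes "unital_positive_map (\<Phi> :: 'a::unital_cstar_algebra \<Rightarrow> 'a)"
    and h: "star h = h" "\<Phi> h = h" "\<Phi> (h * h) = h * h" and x: "\<Phi> x = x" "x * h = h * x"
  shows "\<Phi> (h * x) = h * x"
proof -
  interpret unital_positive_map \<Phi> by fact
  have "\<Phi> (h * x + x * h) = h * x + x * h"
    using jordan_multiplicative[of h x] h x by simp
  then have "2 *\<^sub>R \<Phi> (h * x) = 2 *\<^sub>R (h * x)"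
    using x(2) by (simp add: map_add scaleR_2)
  then show ?thesis by simp
qed

theorem corollary2p3:
  fixes \<Phi> :: "'a::unital_cstar_algebra \<Rightarrow> 'a" and a :: 'a
  assumes "Vector_Spaces.linear scaleC scaleC \<Phi>"
    and "positive_map \<Phi>"
    and "unital_map \<Phi>"
    and "normal_element a"
  shows "(\<Phi> a = a \<and> \<Phi> (star a * a) = star a * a)
     \<longleftrightarrow> (\<forall>b \<in> cstar_generated {1, a}. \<Phi> b = b)"
proof
  assume "\<forall>b \<in> cstar_generated {1, a}. \<Phi> b = b"
  then show "\<Phi> a = a \<and> \<Phi> (star a * a) = star a * a"
    by (simp add: in_cstar_generated star_mult_in_cstar_generated)
next
  interpret unital_positive_map \<Phi>
    by (rule unital_positive_map.intro[OF assms(1-3)])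
  assume fix_a: "\<Phi> a = a \<and> \<Phi> (star a * a) = star a * a"
  obtain h k where hk: "star h = h" "star k = k" "a = h + \<i> *\<^sub>C k"
    using cartesian_decomposition by blast
  have sa: "star a = h - \<i> *\<^sub>C k"
    by (simp add: hk star_add star_scaleC)
  have sum_a: "a + star a = 2 *\<^sub>R h" and diff_a: "a - star a = 2 *\<^sub>R (\<i> *\<^sub>C k)"
    unfolding sa by (simp_all add: hk(3) scaleR_2)
  have h: "h = (1/2) *\<^sub>R (a + star a)" and k: "k = (1/2) *\<^sub>R ((- \<i>) *\<^sub>C (a - star a))"
    by (simp_all add: sum_a diff_a scaleC_scaleR_commute)
  have fix_hk: "\<Phi> h = h" "\<Phi> k = k"
    unfolding h k map_scaleR map_scaleC map_add map_diff map_star using fix_a by simp_all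
  have normal: "star a * a = a * star a"
    using assms(4) by (simp add: normal_element_def)
  have "(a + star a) * (a - star a) = (a - star a) * (a + star a)"
    by (simp add: algebra_simps normal)
  then have "h * k = k * h"
    unfolding h k by (simp only: mult_scaleC_left mult_scaleC_right mult_scaleR_left
        mult_scaleR_right scaleC_scaleR_commute)
  then have aa: "star a * a = h * h + k * k"
    unfolding sa by (simp add: hk(3) algebra_simps mult_scaleC_left mult_scaleC_right)
  \<comment> \<open>The two defects in Kadison's inequality are positive and add up to zero, so both vanish.\<close>
  define D where "D x = \<Phi> (x * x) - \<Phi> x * \<Phi> x" for x
  have "D h + D k = 0"
    using fix_a unfolding aa by (simp add: D_def map_add fix_hk algebra_simps)
  then have "D k = - D h"
    by (simp add: add_eq_0_iff)
  then have "D h = 0"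
    using kadison_inequality hk unfolding D_def by (metis positive_antisym)
  with \<open>D k = - D h\<close> have sq: "\<Phi> (h * h) = h * h" "\<Phi> (k * k) = k * k"
    by (simp_all add: D_def fix_hk)
  \<comment> \<open>Commuting with \<open>a\<close> and \<open>a\<^sup>*\<close> turns the Jordan products of elements of \<open>J\<close> with \<open>h\<close> and \<open>k\<close> into
    ordinary ones.\<close>
  define J where "J = {x. \<Phi> x = x \<and> x * a = a * x \<and> x * star a = star a * x}"
  have "module.subspace scaleC J"
    by (auto simp: scaleC.subspace_def J_def map_zero map_add map_scaleC distrib_left distrib_right
        mult_scaleC_left mult_scaleC_right)
  moreover have "closed J"
    unfolding J_def
    by (intro closed_Collect_conj closed_Collect_eq continuous_intros
        bounded_linear.continuous_on[OF bounded_linear_map continuous_on_id])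
  ultimately have B: "cstar_subalgebra {b. \<forall>x\<in>J. b * x \<in> J \<and> star b * x \<in> J}" (is "cstar_subalgebra ?B")
    by (rule cstar_subalgebra_multipliers)
  have "a * x \<in> J \<and> star a * x \<in> J" if "x \<in> J" for x
  proof -
    have x: "\<Phi> x = x" "x * a = a * x" "x * star a = star a * x"
      using that by (simp_all add: J_def)
    have "x * h = h * x" "x * k = k * x"
      unfolding h k by (simp_all add: distrib_left distrib_right left_diff_distrib
          right_diff_distrib mult_scaleC_left mult_scaleC_right x(2,3))
    then have "\<Phi> (h * x) = h * x" "\<Phi> (k * x) = k * x"
      using fixed_jordan_factor[OF unital_positive_map_axioms] hk fix_hk sq x(1) by blast+
    then have "\<Phi> (a * x) = a * x" "\<Phi> (star a * x) = star a * x"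
      unfolding sa by (simp_all add: hk(3) distrib_right left_diff_distrib mult_scaleC_left
          map_add map_diff map_scaleC)
    moreover have "a * x * a = a * (a * x)" "a * x * star a = star a * (a * x)"
        "star a * x * a = a * (star a * x)" "star a * x * star a = star a * (star a * x)"
      by (simp_all only: mult.assoc x(2,3)) (simp_all only: normal flip: mult.assoc)
    ultimately show ?thesis
      by (simp add: J_def)
  qed
  then have "{1, a} \<subseteq> ?B"
    by simp
  with B have "cstar_generated {1, a} \<subseteq> ?B"
    unfolding cstar_generated_def by blast
  moreover have "1 \<in> J"
    by (simp add: J_def)
  ultimately have "cstar_generated {1, a} \<subseteq> J"
    by (metis (no_types, lifting) mem_Collect_eq mult_1_right subset_iff)
  then show "\<forall>b \<in> cstar_generated {1, a}. \<Phi> b = b"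
    unfolding J_def by blast
qed

end
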